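(* Let $a\in(0,1)$ and let $f_1:[0,a]\to[0,1]$ be an (orientation-preserving, onto) expanding $C^1$-diffeomorphism. Then there exists a unique extension of $f_1$ to a Lebesgue-preserving full branch expanding transformation $f$ of the unit interval, i.e. there is a unique $C^1$ orientation-preserving expanding diffeomorphism $f_2:[a,1]\to[0,1]$ such that the map $f$ with branches $f_1$ on $[0,a]$ and $f_2$ on $[a,1]$ preserves Lebesgue measure on $[0,1]$. This extension represents a $C^1$ map on the circle if and only if $$f_1'(0)=\frac{f_1'(a)}{f_1'(a)-1}.$$ In particular, for every $\omega\in K$ there exists an uncountable set of maps in $\Gamma^1_\omega(\mathbb S^1)$ which preserve Lebesgue measure.
   Context: A $C^1$ map between intervals is called expanding here if its derivative is everywhere of absolute value greater than $1$ (one-sided derivatives at endpoints). A full branch map of $[0,1]$ with branches $f_1$ on $[0,a]$ and $f_2$ on $[a,1]$ has each branch mapping its domain onto $[0,1]$ (the value at the single point $a$ is irrelevant). It represents a $C^1$ map on the circle $\mathbb S^1=\mathbb R/\mathbb Z$ if the map induced by identifying $0$ and $1$ is $C^1$, i.e. $f_1'(a)=f_2'(a)$ and $f_1'(0)=f_2'(1)$ (one-sided derivatives). $\mathbb R^+=[0,\infty)$; $\mathbb S^1$ carries the arc-length metric $d$. $E^1(\mathbb S^1)$ is the set of $C^1$ uniformly expanding maps $f:\mathbb S^1\to\mathbb S^1$ (i.e. $\min|f'|>1$). For a continuous real function $\rho$ on a compact metric space $X$, the canonical modulus of continuity is $\omega_\rho(t)=\sup\{|\rho(x)-\rho(y)|: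 d(x,y)<t\}$ for $t>0$, with $\omega_\rho(0)=0$. $K$ is the set of continuous, non-decreasing, concave functions $\omega:\mathbb R^+\to\mathbb R^+$ with $\omega(0)=0$ and $\omega\not\equiv0$. For moduli of continuity, $\omega\simeq\tilde\omega$ means that the ratio $\omega/\tilde\omega$ is bounded above and bounded below by positive constants on some interval $(0,t_0]$, $t_0>0$. $E^1_\omega(\mathbb S^1)=\{f\in E^1(\mathbb S^1):\omega_{f'}\simeq\omega\}$, and $\Gamma^1_\omega(\mathbb S^1)$ is the set of $f\in E^1_\omega(\mathbb S^1)$ that admit an invariant probability measure equivalent to Lebesgue (mutually absolutely continuous with it). *)

theory Defs
  imports "HOL-Probability.Probability"
begin

section \<open>Maps of intervals\<close>

text \<open>At the endpoints of a compact interval, the derivative within the interval is the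
  one-sided derivative.\<close>

definition C1_on :: "real set \<Rightarrow> (real \<Rightarrow> real) \<Rightarrow> bool" where
  "C1_on S f \<longleftrightarrow> f differentiable_on S \<and>
     continuous_on S (\<lambda>x. vector_derivative f (at x within S))"

definition C1_diffeo :: "real set \<Rightarrow> real set \<Rightarrow> (real \<Rightarrow> real) \<Rightarrow> bool" where
  "C1_diffeo S T f \<longleftrightarrow> bij_betw f S T \<and> C1_on S f \<and> C1_on T (inv_into S f)"

definition expanding_on :: "real set \<Rightarrow> (real \<Rightarrow> real) \<Rightarrow> bool" where
  "expanding_on S f \<longleftrightarrow> (\<forall>x\<in>S. \<bar>vector_derivative f (at x within S)\<bar> > 1)"

definition increasing_full_branch :: "real set \<Rightarrow> (real \<Rightarrow> real) \<Rightarrow> bool" where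
  "increasing_full_branch S f \<longleftrightarrow>
     C1_diffeo S {0..1} f \<and> strict_mono_on S f \<and> expanding_on S f"

definition two_branch_map :: "real \<Rightarrow> (real \<Rightarrow> real) \<Rightarrow> (real \<Rightarrow> real) \<Rightarrow> real \<Rightarrow> real" where
  "two_branch_map a f1 f2 x = (if x \<le> a then f1 x else f2 x)"

definition measure_preserving_map :: "'a measure \<Rightarrow> ('a \<Rightarrow> 'a) \<Rightarrow> bool" where
  "measure_preserving_map M T \<longleftrightarrow> T \<in> M \<rightarrow>\<^sub>M M \<and> distr M M T = M"

definition lebesgue_preserving_extension ::
    "real \<Rightarrow> (real \<Rightarrow> real) \<Rightarrow> (real \<Rightarrow> real) \<Rightarrow> bool" where
  "lebesgue_preserving_extension a f1 f2 \<longleftrightarrow>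
     increasing_full_branch {a..1} f2 \<and>
     measure_preserving_map (restrict_space lborel {0..1}) (two_branch_map a f1 f2)"


section \<open>The circle\<close>

quotient_type circle = real / "\<lambda>x y::real. x - y \<in> \<int>"
proof (rule equivpI)
  show "reflp (\<lambda>x y::real. x - y \<in> \<int>)"
    by (simp add: reflp_def)
  show "symp (\<lambda>x y::real. x - y \<in> \<int>)"
  proof (rule sympI)
    fix x y :: real
    assume "x - y \<in> \<int>"
    then have "- (x - y) \<in> \<int>"
      by (rule Ints_minus)
    then show "y - x \<in> \<int>"
      by simp
  qed
  show "transp (\<lambda>x y::real. x - y \<in> \<int>)"
  proof (rule transpI)
    fix x y z :: real
    assume "x - y \<in> \<int>" "y - z \<in> \<int>"
    then have "(x - y) + (y - z) \<in> \<int>"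
      by (rule Ints_add)
    then show "x - z \<in> \<int>"
      by simp
  qed
qed

lift_definition circle_of :: "real \<Rightarrow> circle" is "\<lambda>x. x" .

text \<open>The representative in \<open>[0, 1)\<close>.\<close>

lift_definition unit_rep :: "circle \<Rightarrow> real" is frac
proof -
  fix x y :: real
  assume "x - y \<in> \<int>"
  then obtain k where "x - y = of_int k"
    by (rule Ints_cases)
  then have "x = y + of_int k"
    by simp
  then show "frac x = frac y"
    by (simp add: frac_def)
qed

text \<open>The arc-length metric on the circle of length 1: the distance of the difference of two
  representatives to the nearest integer.\<close>

instantiation circle :: metric_space
begin

lift_definition dist_circle :: "circle \<Rightarrow> circle \<Rightarrow> real" is
  "\<lambda>x y. \<bar>x - y - of_int (round (x - y))\<bar>"
proof -
  fix x x' y y' :: real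
  assume "x - x' \<in> \<int>" "y - y' \<in> \<int>"
  then have "(x - x') - (y - y') \<in> \<int>"
    by (rule Ints_diff)
  then obtain k where "(x - x') - (y - y') = of_int k"
    by (rule Ints_cases)
  then have k: "x - y = (x' - y') + of_int k"
    by simp
  have "(x - y) + 1 / 2 = (x' - y' + 1 / 2) + of_int k"
    unfolding k by simp
  then have "round (x - y) = round (x' - y') + k"
    unfolding round_def by (simp only: floor_add_int)
  with k show "\<bar>x - y - of_int (round (x - y))\<bar> = \<bar>x' - y' - of_int (round (x' - y'))\<bar>"
    by (simp only: of_int_add add_diff_cancel_right)
qed

definition uniformity_circle :: "(circle \<times> circle) filter" where
  "uniformity_circle = (INF e\<in>{0<..}. principal {(x, y). dist x y < e})"

definition open_circle :: "circle set \<Rightarrow> bool" where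
  "open_circle U \<longleftrightarrow> (\<forall>x\<in>U. \<forall>\<^sub>F (x', y) in uniformity. x' = x \<longrightarrow> y \<in> U)"

instance
proof
  fix p q r :: circle
  show "dist p q = 0 \<longleftrightarrow> p = q"
  proof transfer
    fix x y :: real
    show "\<bar>x - y - of_int (round (x - y))\<bar> = 0 \<longleftrightarrow> x - y \<in> \<int>"
    proof
      assume "\<bar>x - y - of_int (round (x - y))\<bar> = 0"
      then have "of_int (round (x - y)) = x - y"
        by linarith
      with Ints_of_int[of "round (x - y)", where ?'a = real] show "x - y \<in> \<int>"
        by (simp only:)
    next
      assume "x - y \<in> \<int>"
      then show "\<bar>x - y - of_int (round (x - y))\<bar> = 0"
        by (auto elim: Ints_cases)
    qed
  qed
  show "dist p q \<le> dist p r + dist q r"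
  proof transfer
    fix x y z :: real
    have "\<bar>x - y - of_int (round (x - y))\<bar>
        \<le> \<bar>(x - y) - of_int (round (x - z) - round (y - z))\<bar>"
      by (rule round_diff_minimal)
    then show "\<bar>x - y - of_int (round (x - y))\<bar>
        \<le> \<bar>x - z - of_int (round (x - z))\<bar> + \<bar>y - z - of_int (round (y - z))\<bar>"
      unfolding of_int_diff by linarith
  qed
  show "uniformity = (INF e\<in>{0<..}. principal {(x, y :: circle). dist x y < e})"
    by (rule uniformity_circle_def)
  show "open U \<longleftrightarrow> (\<forall>x\<in>U. \<forall>\<^sub>F (x', y) in uniformity. x' = x \<longrightarrow> y \<in> U)"
    for U :: "circle set"
    by (rule open_circle_def)
qed

end

definition circle_lebesgue :: "circle measure" where
  "circle_lebesgue = distr (restrict_space lborel {0..<1}) borel circle_of"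

text \<open>The map induced on the circle by a map of \<open>[0, 1]\<close>; it agrees with the map obtained by
  identifying 0 and 1 whenever \<open>f 0\<close> and \<open>f 1\<close> are congruent modulo 1.\<close>

definition induced_circle_map :: "(real \<Rightarrow> real) \<Rightarrow> circle \<Rightarrow> circle" where
  "induced_circle_map f p = circle_of (f (unit_rep p))"

text \<open>The lift \<open>F\<close> need not be continuous away from \<open>x\<close>, so this is differentiability at a single
  point.\<close>

definition has_circle_derivative :: "(circle \<Rightarrow> circle) \<Rightarrow> real \<Rightarrow> circle \<Rightarrow> bool" where
  "has_circle_derivative f D p \<longleftrightarrow>
     (\<exists>F x. (\<forall>y. circle_of (F y) = f (circle_of y)) \<and> circle_of x = p \<and>
        (F has_real_derivative D) (at x))"

lemma has_circle_derivative_unique: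
  assumes "has_circle_derivative f D p" "has_circle_derivative f E p"
  shows "D = E"
proof -
  obtain F x where F: "\<And>y. circle_of (F y) = f (circle_of y)" "circle_of x = p"
    "(F has_real_derivative D) (at x)"
    using assms(1) unfolding has_circle_derivative_def by blast
  obtain G x' where G: "\<And>y. circle_of (G y) = f (circle_of y)" "circle_of x' = p"
    "(G has_real_derivative E) (at x')"
    using assms(2) unfolding has_circle_derivative_def by blast
  have eq_iff: "circle_of u = circle_of v \<longleftrightarrow> u - v \<in> \<int>" for u v
    by transfer simp
  define k where "k = x' - x"
  have k: "k \<in> \<int>"
    using F(2) G(2) eq_iff by (auto simp: k_def)
  define H where "H y = F y - G (y + k)" for y
  have H_int: "H y \<in> \<int>" for y
  proof -
    have "circle_of (y + k) = circle_of y"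
      using k by (simp add: eq_iff)
    then show ?thesis
      using F(1)[of y] G(1)[of "y + k"] by (simp add: H_def flip: eq_iff)
  qed
  have "((\<lambda>y. G (y + k)) has_real_derivative E) (at x)"
    using G(3) DERIV_shift[of G E x k] by (simp add: k_def)
  then have dH: "(H has_real_derivative D - E) (at x)"
    unfolding H_def using F(3) by (intro DERIV_diff)
  then have "(H \<longlongrightarrow> H x) (at x)"
    using DERIV_isCont isContD by blast
  then have "\<forall>\<^sub>F y in at x. dist (H y) (H x) < 1"
    by (rule tendstoD) simp
  then have "\<forall>\<^sub>F y in at x. H y = H x"
  proof eventually_elim
    case (elim y)
    then show ?case
      using Ints_nonzero_abs_less1[of "H y - H x"] H_int by (auto simp: dist_real_def)
  qed
  then have "\<forall>\<^sub>F y in at x. (H y - H x) / (y - x) = 0"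
    by eventually_elim simp
  then have "((\<lambda>y. (H y - H x) / (y - x)) \<longlongrightarrow> 0) (at x)"
    by (rule tendsto_eventually)
  with dH have "D - E = 0"
    unfolding has_field_derivative_iff by (intro tendsto_unique) auto
  then show ?thesis
    by simp
qed

definition circle_deriv :: "(circle \<Rightarrow> circle) \<Rightarrow> circle \<Rightarrow> real" where
  "circle_deriv f p = (THE D. has_circle_derivative f D p)"

definition circle_C1 :: "(circle \<Rightarrow> circle) \<Rightarrow> bool" where
  "circle_C1 f \<longleftrightarrow> (\<forall>p. \<exists>D. has_circle_derivative f D p) \<and> continuous_on UNIV (circle_deriv f)"

definition E1 :: "(circle \<Rightarrow> circle) set" where
  "E1 = {f. circle_C1 f \<and> (\<exists>c>1. \<forall>p. c \<le> \<bar>circle_deriv f p\<bar>)}"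


section \<open>Moduli of continuity\<close>

definition canonical_modulus :: "('a::metric_space \<Rightarrow> real) \<Rightarrow> real \<Rightarrow> real" where
  "canonical_modulus \<rho> t =
     (if t > 0 then Sup {\<bar>\<rho> x - \<rho> y\<bar> | x y. dist x y < t} else 0)"

definition concave_moduli :: "(real \<Rightarrow> real) set" where
  "concave_moduli = {\<omega>. continuous_on {0..} \<omega> \<and> mono_on {0..} \<omega> \<and> concave_on {0..} \<omega> \<and>
     (\<forall>t\<ge>0. \<omega> t \<ge> 0) \<and> \<omega> 0 = 0 \<and> (\<exists>t\<ge>0. \<omega> t \<noteq> 0)}"

definition equiv_moduli :: "(real \<Rightarrow> real) \<Rightarrow> (real \<Rightarrow> real) \<Rightarrow> bool" where
  "equiv_moduli \<omega> \<omega>' \<longleftrightarrow>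
     (\<exists>t0>0. \<exists>c>0. \<exists>C. \<forall>t\<in>{0<..t0}. c \<le> \<omega> t / \<omega>' t \<and> \<omega> t / \<omega>' t \<le> C)"

definition E1_mod :: "(real \<Rightarrow> real) \<Rightarrow> (circle \<Rightarrow> circle) set" where
  "E1_mod \<omega> = {f \<in> E1. equiv_moduli (canonical_modulus (circle_deriv f)) \<omega>}"

definition Gamma1_mod :: "(real \<Rightarrow> real) \<Rightarrow> (circle \<Rightarrow> circle) set" where
  "Gamma1_mod \<omega> = {f \<in> E1_mod \<omega>. \<exists>\<mu>. prob_space \<mu> \<and> sets \<mu> = sets borel \<and>
     measure_preserving_map \<mu> f \<and>
     absolutely_continuous circle_lebesgue \<mu> \<and> absolutely_continuous \<mu> circle_lebesgue}"

end

theory Submission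
  imports Defs
begin

text \<open>Everything becomes linear when a branch \<open>f\<close> is replaced by its inverse \<open>g\<close>. The map with
  branches \<open>f1\<close>, \<open>f2\<close> pulls \<open>[0, y]\<close> back to \<open>[0, g1 y] \<union> (a, g2 y]\<close>, so it preserves Lebesgue measure iff
  \<open>g1 y + g2 y = a + y\<close> for all \<open>y\<close> (lemma \<open>two_branch_measure_preserving_iff\<close>). This equation leaves
  exactly one candidate \<open>g2\<close>, whose slope is \<open>1 - g1'\<close>. A branch is an expanding increasing \<open>C\<^sup>1\<close>
  diffeomorphism iff the slope of its inverse is continuous with values in \<open>(0, 1)\<close>, a condition
  symmetric under \<open>d \<mapsto> 1 - d\<close>; so the candidate is always admissible, and the extension exists and is
  unique (lemma \<open>ex1_lebesgue_preserving_extension\<close>).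

  On the circle, the derivatives have to match at \<open>a\<close> and at \<open>0 = 1\<close>. In terms of the inverse slopes
  \<open>d\<close> and \<open>1 - d\<close> of the two branches these requirements are \<open>d 1 = 1 - d 0\<close> and \<open>d 0 = 1 - d 1\<close>.
  They coincide, and \<open>d 0 = 1 / f1' 0\<close>, \<open>d 1 = 1 / f1' a\<close> turn them into the stated condition
  (lemmas \<open>extension_circle_C1_iff\<close> and \<open>slope_condition_iff\<close>).

  For the uncountable family, any continuous \<open>d\<close> with values in \<open>(0, 1)\<close> is the inverse slope of some
  first branch, and only \<open>d 0 + d 1 = 1\<close> is needed to get a circle map. Given \<open>\<omega>\<close> and \<open>0 < q < 1/2\<close>, the
  choice \<open>d x = q + (1 - 2 q) \<omega> x / \<omega> 1\<close> satisfies it. Concavity makes \<open>\<omega>\<close> subadditive, hence \<open>\<omega>\<close> is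
  up to a factor the modulus of continuity of \<open>d\<close>, attained near 0. The derivative of the circle map is
  \<open>1 / d\<close> or \<open>1 / (1 - d)\<close> composed with a branch; branches are bi-Lipschitz and concave moduli are
  insensitive up to a factor to dilations, so the derivative has modulus equivalent to \<open>\<omega>\<close>. The derivative
  at the point 0 of the circle is \<open>1 / q\<close>, which separates the maps for different \<open>q\<close> (lemma
  \<open>ex_lebesgue_preserving_circle_map\<close>).\<close>

section \<open>Differentiation on intervals and inverse branches\<close>

text \<open>Phrases continuous differentiability through a witness for the derivative, which unlike
  \<open>vector_derivative\<close> can be computed with.\<close>

lemma C1_on_Icc_iff:
  fixes f :: "real \<Rightarrow> real"
  assumes "u < v"
  shows "C1_on {u..v} f \<longleftrightarrow>
    (\<exists>D. continuous_on {u..v} D \<and> (\<forall>x\<in>{u..v}. (f has_real_derivative D x) (at x within {u..v})))"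
    (is "?L \<longleftrightarrow> ?R")
proof
  assume L: ?L
  let ?D = "\<lambda>x. vector_derivative f (at x within {u..v})"
  have "(f has_real_derivative ?D x) (at x within {u..v})" if "x \<in> {u..v}" for x
    using L that unfolding C1_on_def differentiable_on_def
    by (simp add: has_real_derivative_iff_has_vector_derivative flip: vector_derivative_works)
  with L show ?R
    unfolding C1_on_def by blast
next
  assume ?R
  then obtain D where D: "continuous_on {u..v} D"
    "\<And>x. x \<in> {u..v} \<Longrightarrow> (f has_real_derivative D x) (at x within {u..v})"
    by blast
  have "vector_derivative f (at x within {u..v}) = D x" if "x \<in> {u..v}" for x
    using vector_derivative_within_closed_interval[OF assms that] D(2)[OF that]
    by (simp add: has_real_derivative_iff_has_vector_derivative)
  then have "continuous_on {u..v} (\<lambda>x. vector_derivative f (at x within {u..v}))"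
    by (rule continuous_on_eq[OF D(1) sym])
  moreover have "f differentiable_on {u..v}"
    unfolding differentiable_on_def real_differentiable_def using D(2) by blast
  ultimately show ?L
    unfolding C1_on_def by blast
qed

lemma vector_derivative_Icc:
  fixes f :: "real \<Rightarrow> real"
  assumes "u < v" "x \<in> {u..v}" "(f has_real_derivative D) (at x within {u..v})"
  shows "vector_derivative f (at x within {u..v}) = D"
  using vector_derivative_within_closed_interval[OF assms(1,2)] assms(3)
  by (simp add: has_real_derivative_iff_has_vector_derivative)

lemma has_real_derivative_transform:
  fixes f h :: "real \<Rightarrow> real"
  assumes "x \<in> S" "\<And>z. z \<in> S \<Longrightarrow> h z = f z" "(f has_real_derivative D) (at x within S)"
  shows "(h has_real_derivative D) (at x within S)"
  using has_derivative_transform[OF assms(1), of h f] assms(2,3)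
  unfolding has_field_derivative_def by blast

text \<open>The one-sided form of the inverse function rule, needed because branches live on closed intervals:
  the difference quotients of \<open>f\<close> are the reciprocals of those of \<open>g\<close> along \<open>z \<mapsto> f z\<close>.\<close>

lemma has_real_derivative_inverse_within:
  fixes f g :: "real \<Rightarrow> real"
  assumes g: "(g has_real_derivative d) (at (f x) within T)" and "d \<noteq> 0"
    and f: "continuous (at x within S) f" "x \<in> S" "\<And>z. z \<in> S \<Longrightarrow> f z \<in> T \<and> g (f z) = z"
  shows "(f has_real_derivative 1 / d) (at x within S)"
proof -
  have "filterlim f (at (f x) within T) (at x within S)"
    unfolding filterlim_at
  proof
    show "\<forall>\<^sub>F z in at x within S. f z \<in> T \<and> f z \<noteq> f x"
      unfolding eventually_at_filter using f(2,3) by (intro always_eventually) metis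
    show "(f \<longlongrightarrow> f x) (at x within S)"
      using f(1) by (simp add: continuous_within)
  qed
  with g have "((\<lambda>z. (g (f z) - g (f x)) / (f z - f x)) \<longlongrightarrow> d) (at x within S)"
    unfolding has_field_derivative_iff by (rule filterlim_compose)
  then have "((\<lambda>z. 1 / ((g (f z) - g (f x)) / (f z - f x))) \<longlongrightarrow> 1 / d) (at x within S)"
    using \<open>d \<noteq> 0\<close> by (intro tendsto_intros)
  moreover have "\<forall>\<^sub>F z in at x within S.
      1 / ((g (f z) - g (f x)) / (f z - f x)) = (f z - f x) / (z - x)"
    unfolding eventually_at_filter using f(2,3) by (intro always_eventually) auto
  ultimately show ?thesis
    unfolding has_field_derivative_iff by (rule Lim_transform_eventually)
qed

text \<open>The normal form of a branch used throughout: \<open>g\<close> is the inverse of \<open>f\<close>, of slope \<open>d\<close>, and expansion of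
  \<open>f\<close> is the bound \<open>d < 1\<close>. Only the values of \<open>f\<close> on \<open>[u, v]\<close> are constrained.\<close>

definition has_inverse_branch ::
    "real \<Rightarrow> real \<Rightarrow> (real \<Rightarrow> real) \<Rightarrow> (real \<Rightarrow> real) \<Rightarrow> (real \<Rightarrow> real) \<Rightarrow> bool" where
  "has_inverse_branch u v f g d \<longleftrightarrow>
     g 0 = u \<and> g 1 = v \<and> (\<forall>y\<in>{0..1}. f (g y) = y) \<and> continuous_on {0..1} d \<and>
     (\<forall>y\<in>{0..1}. 0 < d y \<and> d y < 1 \<and> (g has_real_derivative d y) (at y within {0..1}))"

lemma strict_mono_on_of_pos_derivative:
  fixes g :: "real \<Rightarrow> real"
  assumes "\<And>y. y \<in> {u..v} \<Longrightarrow> (g has_real_derivative d y) (at y within {u..v}) \<and> 0 < d y"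
  shows "strict_mono_on {u..v} g"
proof (rule strict_mono_onI)
  fix r s assume rs: "r \<in> {u..v}" "s \<in> {u..v}" "r < s"
  have der: "(g has_real_derivative d y) (at y within {r..s})" if "y \<in> {r..s}" for y
    using assms[of y] that rs by (auto intro: DERIV_subset)
  have "continuous_on {r..s} g"
    using der by (rule DERIV_continuous_on)
  moreover have "(g has_real_derivative d y) (at y)" if "y \<in> {r<..<s}" for y
    using der[of y] that at_within_Icc_at[of r y s] by simp
  ultimately obtain l z where "r < z" "z < s" "(g has_real_derivative l) (at z)"
     "g s - g r = (s - r) * l"
    using MVT[of r s g] rs(3) real_differentiable_def by (metis greaterThanLessThan_iff)
  moreover from this have "l = d z"
    using \<open>\<And>y. y \<in> {r<..<s} \<Longrightarrow> _\<close>[of z] DERIV_unique by auto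
  ultimately show "g r < g s"
    using assms[of z] rs by (smt (verit) atLeastAtMost_iff mult_pos_pos)
qed

lemma inverse_branch_strict_mono_on: "has_inverse_branch u v f g d \<Longrightarrow> strict_mono_on {0..1} g"
  by (rule strict_mono_on_of_pos_derivative[where d = d]) (auto simp: has_inverse_branch_def)

lemma inverse_branch_continuous_on: "has_inverse_branch u v f g d \<Longrightarrow> continuous_on {0..1} g"
  by (rule DERIV_continuous_on[where D = d]) (auto simp: has_inverse_branch_def)

lemma inverse_branch_image:
  assumes "has_inverse_branch u v f g d"
  shows "g ` {0..1} = {u..v}"
proof
  have g: "g 0 = u" "g 1 = v"
    using assms by (auto simp: has_inverse_branch_def)
  show "g ` {0..1} \<subseteq> {u..v}"
    using strict_mono_on_leD[OF inverse_branch_strict_mono_on[OF assms], of 0]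
      strict_mono_on_leD[OF inverse_branch_strict_mono_on[OF assms], of _ 1] g by auto
  show "{u..v} \<subseteq> g ` {0..1}"
    using IVT'[of g 0 _ 1] inverse_branch_continuous_on[OF assms] g by fastforce
qed

text \<open>Together with the next lemma, this makes \<open>has_inverse_branch\<close> a characterisation of increasing full
  branches.\<close>

lemma full_branch_of_inverse_branch:
  assumes "has_inverse_branch u v f g d"
  shows "increasing_full_branch {u..v} f"
    and "\<And>x. x \<in> {u..v} \<Longrightarrow> (f has_real_derivative 1 / d (f x)) (at x within {u..v})"
    and "\<And>y. y \<in> {0..1} \<Longrightarrow> inv_into {u..v} f y = g y"
proof -
  note img = inverse_branch_image[OF assms]
  note sm = inverse_branch_strict_mono_on[OF assms]
  have fg: "f (g y) = y" if "y \<in> {0..1}" for y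
    using assms that by (auto simp: has_inverse_branch_def)
  have d: "0 < d y" "d y < 1" "(g has_real_derivative d y) (at y within {0..1})"
    if "y \<in> {0..1}" for y
    using assms that by (auto simp: has_inverse_branch_def)
  have uv: "u < v"
    using strict_mono_onD[OF sm, of 0 1] assms by (auto simp: has_inverse_branch_def)
  have gf: "f x \<in> {0..1} \<and> g (f x) = x" if "x \<in> {u..v}" for x
    using that img fg by (metis imageE)
  have bij: "bij_betw f {u..v} {0..1}"
    by (rule bij_betwI[where g = g]) (use gf img fg in auto)
  have contf: "continuous_on {u..v} f"
    using continuous_on_inv[OF inverse_branch_continuous_on[OF assms], of f] fg img by simp
  show der: "(f has_real_derivative 1 / d (f x)) (at x within {u..v})" if "x \<in> {u..v}" for x
    by (rule has_real_derivative_inverse_within[where T = "{0..1}" and g = g])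
      (use gf d[of "f x"] contf that in \<open>auto simp: continuous_on_eq_continuous_within\<close>)
  show inv: "inv_into {u..v} f y = g y" if "y \<in> {0..1}" for y
    by (rule inv_into_f_eq) (use bij fg that img in \<open>auto simp: bij_betw_def\<close>)
  have "C1_on {u..v} f"
    unfolding C1_on_Icc_iff[OF uv]
  proof (intro exI conjI ballI)
    have "continuous_on {u..v} (\<lambda>x. d (f x))"
      by (rule continuous_on_compose2[OF _ contf]) (use assms gf in \<open>auto simp: has_inverse_branch_def\<close>)
    then show "continuous_on {u..v} (\<lambda>x. 1 / d (f x))"
      by (intro continuous_intros) (use d gf in force)+
  qed (rule der)
  moreover have "C1_on {0..1} (inv_into {u..v} f)"
  proof -
    have "(inv_into {u..v} f has_real_derivative d y) (at y within {0..1})" if "y \<in> {0..1}" for y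
      using has_real_derivative_transform[OF that inv d(3)[OF that]] .
    then show ?thesis
      using assms by (subst C1_on_Icc_iff) (auto simp: has_inverse_branch_def)
  qed
  moreover have "strict_mono_on {u..v} f"
  proof (rule strict_mono_onI)
    fix r s assume "r \<in> {u..v}" "s \<in> {u..v}" "r < s"
    then show "f r < f s"
      using gf[of r] gf[of s] strict_mono_on_leD[OF sm, of "f s" "f r"] by (cases "f r < f s") auto
  qed
  moreover have "expanding_on {u..v} f"
    unfolding expanding_on_def
  proof
    fix x assume x: "x \<in> {u..v}"
    then show "\<bar>vector_derivative f (at x within {u..v})\<bar> > 1"
      using vector_derivative_Icc[OF uv x der[OF x]] d[of "f x"] gf[OF x] by simp
  qed
  ultimately show "increasing_full_branch {u..v} f"
    using bij unfolding increasing_full_branch_def C1_diffeo_def by blast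
qed

text \<open>The chain rule for \<open>f (g y) = y\<close> gives \<open>f' g' = 1\<close>; monotonicity fixes the sign of \<open>f'\<close>, and
  \<open>|f'| > 1\<close> becomes \<open>0 < g' < 1\<close>.\<close>

lemma inverse_branch_of_full_branch:
  assumes "u < v" "increasing_full_branch {u..v} f"
  obtains d where "has_inverse_branch u v f (inv_into {u..v} f) d"
proof -
  let ?g = "inv_into {u..v} f"
  have bij: "bij_betw f {u..v} {0..1}" and sm: "strict_mono_on {u..v} f"
    and "C1_on {u..v} f" "C1_on {0..1} ?g" and ex: "expanding_on {u..v} f"
    using assms(2) by (auto simp: increasing_full_branch_def C1_diffeo_def)
  then obtain D where D: "\<And>x. x \<in> {u..v} \<Longrightarrow> (f has_real_derivative D x) (at x within {u..v})"
    using C1_on_Icc_iff[OF assms(1)] by blast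
  obtain d where d: "continuous_on {0..1} d"
    "\<And>y. y \<in> {0..1} \<Longrightarrow> (?g has_real_derivative d y) (at y within {0..1})"
    using \<open>C1_on {0..1} ?g\<close> C1_on_Icc_iff[OF zero_less_one] by blast
  have img: "f ` {u..v} = {0..1}" and inj: "inj_on f {u..v}"
    using bij by (auto simp: bij_betw_def)
  have gf: "?g (f x) = x" if "x \<in> {u..v}" for x
    using inj that by (rule inv_into_f_f)
  have fg: "?g y \<in> {u..v} \<and> f (?g y) = y" if "y \<in> {0..1}" for y
    using that f_inv_into_f[of y f "{u..v}"] inv_into_into[of y f "{u..v}"] img by auto
  have mono: "f u \<le> f x" "f x \<le> f v" if "x \<in> {u..v}" for x
    using strict_mono_on_leD[OF sm, of u x] strict_mono_on_leD[OF sm, of x v] that assms(1) by auto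
  have "f u = 0" "f v = 1"
  proof -
    have "f u \<in> {0..1}" "f v \<in> {0..1}"
      using bij_betwE[OF bij] assms(1) by auto
    then show "f u = 0" "f v = 1"
      using mono[of "?g 0"] mono[of "?g 1"] fg[of 0] fg[of 1] by auto
  qed
  then have ends: "?g 0 = u" "?g 1 = v"
    using gf[of u] gf[of v] assms(1) by auto
  have slope: "0 < d y \<and> d y < 1" if y: "y \<in> {0..1}" for y
  proof -
    define x where "x = ?g y"
    have x: "x \<in> {u..v}" "f x = y"
      using fg[OF y] by (auto simp: x_def)
    have "(f has_real_derivative D x) (at (?g y) within ?g ` {0..1})"
      using DERIV_subset[OF D[OF x(1)], of "?g ` {0..1}"] fg unfolding x_def by blast
    then have 1: "((\<lambda>y. f (?g y)) has_real_derivative D x * d y) (at y within {0..1})"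
      using DERIV_image_chain[OF _ d(2)[OF y], of f] by (simp add: o_def)
    have 2: "((\<lambda>y. f (?g y)) has_real_derivative 1) (at y within {0..1})"
      by (rule has_real_derivative_transform[OF y _ DERIV_ident]) (use fg in blast)
    have "D x * d y = 1"
      using vector_derivative_Icc[OF zero_less_one y 1] vector_derivative_Icc[OF zero_less_one y 2]
      by simp
    moreover have "\<bar>D x\<bar> > 1"
      using bspec[OF ex[unfolded expanding_on_def] x(1)]
        vector_derivative_Icc[OF assms(1) x(1) D[OF x(1)]] by simp
    moreover have "D x \<ge> 0"
    proof (rule tendsto_lowerbound)
      show "((\<lambda>z. (f z - f x) / (z - x)) \<longlongrightarrow> D x) (at x within {u..v})"
        using D[OF x(1)] by (simp add: has_field_derivative_iff)
      show "at x within {u..v} \<noteq> bot"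
        using assms(1) x(1) by (simp add: trivial_limit_within islimpt_Icc)
      show "\<forall>\<^sub>F z in at x within {u..v}. 0 \<le> (f z - f x) / (z - x)"
        unfolding eventually_at_filter
      proof (intro always_eventually allI impI)
        fix z assume z: "z \<noteq> x" "z \<in> {u..v}"
        show "0 \<le> (f z - f x) / (z - x)"
        proof (cases z x rule: linorder_cases)
          case less
          then show ?thesis
            using strict_mono_onD[OF sm z(2) x(1)] by (intro divide_nonpos_neg) auto
        next
          case greater
          then show ?thesis
            using strict_mono_onD[OF sm x(1) z(2)] by (intro divide_nonneg_pos) auto
        qed (use z in simp)
      qed
    qed
    ultimately have "D x > 1" "d y = 1 / D x"
      by (auto simp: field_simps)
    then show ?thesis
      by simp
  qed
  have "has_inverse_branch u v f ?g d"
    unfolding has_inverse_branch_def using ends slope d fg by simp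
  then show thesis
    by (rule that)
qed

lemma full_branch_le_iff:
  assumes "has_inverse_branch u v f g d" "x \<in> {u..v}" "y \<in> {0..1}"
  shows "f x \<le> y \<longleftrightarrow> x \<le> g y"
proof -
  obtain z where z: "z \<in> {0..1}" "x = g z"
    using assms(2) inverse_branch_image[OF assms(1)] by blast
  then show ?thesis
    using strict_mono_on_less_eq[OF inverse_branch_strict_mono_on[OF assms(1)] z(1) assms(3)]
      assms(1) z(1) by (simp add: has_inverse_branch_def)
qed

lemma inverse_branch_bounds:
  assumes "has_inverse_branch u v f g d" "y \<in> {0..1}"
  shows "u \<le> g y" "g y \<le> v"
  using inverse_branch_image[OF assms(1)] assms(2) by (metis atLeastAtMost_iff image_eqI)+

lemma full_branch_range:
  assumes "has_inverse_branch u v f g d" "x \<in> {u..v}"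
  shows "f x \<in> {0..1}" "g (f x) = x"
  using inverse_branch_image[OF assms(1)] assms unfolding has_inverse_branch_def by (metis imageE)+

lemma full_branch_endpoints:
  assumes "has_inverse_branch u v f g d"
  shows "f u = 0" "f v = 1"
  using assms unfolding has_inverse_branch_def by (metis atLeastAtMost_iff order_refl zero_le_one)+

lemma has_inverse_branch_inv_into:
  assumes "continuous_on {0..1} d"
    and d: "\<And>y. y \<in> {0..1} \<Longrightarrow>
      0 < d y \<and> d y < 1 \<and> (g has_real_derivative d y) (at y within {0..1})"
  shows "has_inverse_branch (g 0) (g 1) (inv_into {0..1} g) g d"
proof -
  have "strict_mono_on {0..1} g"
    by (rule strict_mono_on_of_pos_derivative) (use d in blast)
  then have "inj_on g {0..1}"
    by (rule strict_mono_on_imp_inj_on)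
  then show ?thesis
    unfolding has_inverse_branch_def using assms by simp
qed

text \<open>Any admissible slope occurs: integrate it to get the inverse branch, whose total increase is the
  length \<open>a\<close> of the branch domain.\<close>

lemma ex_branch_with_slope:
  assumes "continuous_on {0..1} d" "\<And>y. y \<in> {0..1} \<Longrightarrow> 0 < d y \<and> d y < 1"
  obtains a f g where "0 < a" "a < 1" "has_inverse_branch 0 a f g d"
proof -
  define g where "g x = integral {0..x} d" for x
  have g: "(g has_real_derivative d y) (at y within {0..1})" if "y \<in> {0..1}" for y
    unfolding g_def by (rule integral_has_real_derivative[OF assms(1) that])
  have inv: "has_inverse_branch (g 0) (g 1) (inv_into {0..1} g) g d"
    by (rule has_inverse_branch_inv_into) (use g assms in auto)
  have g0: "g 0 = 0"
    by (simp add: g_def)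
  have "g 0 < g 1"
    using strict_mono_onD[OF inverse_branch_strict_mono_on[OF inv], of 0 1] by simp
  moreover have "strict_mono_on {0..1} (\<lambda>y. y - g y)"
    by (rule strict_mono_on_of_pos_derivative[where d = "\<lambda>y. 1 - d y"])
      (use g assms(2) in \<open>auto intro!: derivative_eq_intros\<close>)
  then have "0 - g 0 < 1 - g 1"
    by (rule strict_mono_onD) auto
  ultimately show thesis
    using that[of "g 1" "inv_into {0..1} g" g] inv g0 by simp
qed

text \<open>An inverse branch starting at 0 has slope below 1, so it stays below the diagonal.\<close>

lemma le_full_branch:
  assumes "has_inverse_branch 0 v f g d" "x \<in> {0..v}"
  shows "x \<le> f x"
proof -
  have "strict_mono_on {0..1} (\<lambda>y. y - g y)"
    by (rule strict_mono_on_of_pos_derivative[where d = "\<lambda>y. 1 - d y"])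
      (use assms(1) in \<open>auto simp: has_inverse_branch_def intro!: derivative_eq_intros\<close>)
  then have "0 - g 0 \<le> f x - g (f x)"
    by (rule strict_mono_on_leD) (use full_branch_range(1)[OF assms] in auto)
  then show ?thesis
    using full_branch_range(2)[OF assms] assms(1) by (simp add: has_inverse_branch_def)
qed

lemma full_branch_slope_continuous_on:
  assumes "has_inverse_branch u v f g d"
  shows "continuous_on {u..v} (\<lambda>x. 1 / d (f x))"
proof -
  have contf: "continuous_on {u..v} f"
    using full_branch_of_inverse_branch(2)[OF assms] by (rule DERIV_continuous_on)
  have d: "continuous_on {0..1} d" "\<And>y. y \<in> {0..1} \<Longrightarrow> 0 < d y"
    using assms by (auto simp: has_inverse_branch_def)
  have "continuous_on {u..v} (\<lambda>x. d (f x))"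
    by (rule continuous_on_compose2[OF d(1) contf]) (use full_branch_range(1)[OF assms] in blast)
  moreover have "d (f x) \<noteq> 0" if "x \<in> {u..v}" for x
    using d(2)[OF full_branch_range(1)[OF assms that]] by simp
  ultimately show ?thesis
    by (intro continuous_intros) auto
qed

section \<open>Preservation of Lebesgue measure\<close>

lemma two_branch_sublevel:
  assumes "has_inverse_branch 0 a f1 g1 d1"
    and "has_inverse_branch a 1 f2 g2 d2"
    and a: "0 < a" "a < 1" and y: "y \<in> {0..1}"
  shows "{x \<in> {0..1}. two_branch_map a f1 f2 x \<le> y} = {0..g1 y} \<union> {a<..g2 y}"
proof -
  have "two_branch_map a f1 f2 x \<le> y \<longleftrightarrow> (if x \<le> a then x \<le> g1 y else x \<le> g2 y)"
    if "x \<in> {0..1}" for x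
    using full_branch_le_iff[OF assms(1) _ y, of x] full_branch_le_iff[OF assms(2) _ y, of x] that
    by (auto simp: two_branch_map_def)
  then show ?thesis
    using inverse_branch_bounds[OF assms(1) y] inverse_branch_bounds[OF assms(2) y] a
    by (auto split: if_splits)
qed

text \<open>The distribution function of the image measure at \<open>y\<close> is the length \<open>g1 y + (g2 y - a)\<close> of the
  sublevel set, and a measure on the line is determined by its distribution function.\<close>

lemma two_branch_measure_preserving_iff:
  assumes "has_inverse_branch 0 a f1 g1 d1"
    and "has_inverse_branch a 1 f2 g2 d2"
    and a: "0 < a" "a < 1"
  shows "measure_preserving_map (restrict_space lborel {0..1}) (two_branch_map a f1 f2) \<longleftrightarrow>
    (\<forall>y\<in>{0..1}. g1 y + g2 y = a + y)"
proof -
  define M :: "real measure" where "M = restrict_space lborel {0..1}"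
  define T where "T = two_branch_map a f1 f2"
  note sub = two_branch_sublevel[OF assms, folded T_def]
  have space: "space M = {0..1}"
    by (simp add: M_def space_restrict_space)
  have prob: "prob_space M"
    by (rule prob_spaceI) (simp add: M_def emeasure_restrict_space space_restrict_space)
  have range: "T x \<in> {0..1}" if "x \<in> {0..1}" for x
    using full_branch_range(1)[OF assms(1), of x] full_branch_range(1)[OF assms(2), of x] that
    by (auto simp: T_def two_branch_map_def)
  have sets: "A \<in> sets M" if "A \<in> sets borel" "A \<subseteq> {0..1}" for A
    using that by (auto simp: M_def sets_restrict_space)
  have sub_sets: "{0..g1 y} \<union> {a<..g2 y} \<subseteq> {0..1}" if "y \<in> {0..1}" for y
    unfolding sub[OF that, symmetric] by blast
  have borelT: "T \<in> borel_measurable M"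
    unfolding borel_measurable_iff_le
  proof
    fix y :: real
    consider "y < 0" | "0 \<le> y" "y \<le> 1" | "y > 1"
      by linarith
    then show "{x \<in> space M. T x \<le> y} \<in> sets M"
    proof cases
      case 1
      then have "{x \<in> space M. T x \<le> y} = {}"
        using range unfolding space by fastforce
      then show ?thesis
        by (simp only: sets.empty_sets)
    next
      case 2
      then have y: "y \<in> {0..1}"
        by simp
      show ?thesis
        unfolding space sub[OF y] by (intro sets sub_sets y) auto
    next
      case 3
      then have "{x \<in> space M. T x \<le> y} = space M"
        using range unfolding space by fastforce
      then show ?thesis
        by (simp only: sets.top)
    qed
  qed
  have measT: "T \<in> M \<rightarrow>\<^sub>M M"
    using borelT range unfolding M_def by (intro measurable_restrict_space2) (auto simp: space_restrict_space)
  have level: "measure M {x \<in> {0..1}. T x \<le> y} = g1 y + g2 y - a" if y: "y \<in> {0..1}" for y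
  proof -
    have b: "0 \<le> g1 y" "g1 y \<le> a" "a \<le> g2 y" "g2 y \<le> 1"
      using inverse_branch_bounds[OF assms(1) y] inverse_branch_bounds[OF assms(2) y] by auto
    have "measure M ({0..g1 y} \<union> {a<..g2 y}) = measure lborel ({0..g1 y} \<union> {a<..g2 y})"
      unfolding M_def using sub_sets[OF y] by (intro measure_restrict_space) auto
    also have "\<dots> = measure lborel {0..g1 y} + measure lborel {a<..g2 y}"
      using b by (intro measure_Union) auto
    also have "\<dots> = g1 y + (g2 y - a)"
      using b by simp
    finally show ?thesis
      unfolding sub[OF y] by simp
  qed
  have level_id: "measure M {x \<in> {0..1}. x \<le> y} = y" "measure M {0..y} = y" if y: "y \<in> {0..1}" for y
  proof -
    have "measure M {0..y} = measure lborel {0..y}"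
      unfolding M_def using y by (intro measure_restrict_space) auto
    then show "measure M {0..y} = y"
      using y by simp
    moreover have "{x \<in> {0..1}. x \<le> y} = {0..y}"
      using y by auto
    ultimately show "measure M {x \<in> {0..1}. x \<le> y} = y"
      by (simp only:)
  qed
  have "(\<forall>y\<in>{0..1}. g1 y + g2 y = a + y)" if "distr M M T = M"
  proof
    fix y :: real assume y: "y \<in> {0..1}"
    have "T -` {0..y} \<inter> space M = {x \<in> {0..1}. T x \<le> y}"
      using range unfolding space by (intro set_eqI) (simp, blast)
    then have "measure (distr M M T) {0..y} = g1 y + g2 y - a"
      using measure_distr[OF measT sets, of "{0..y}"] y by (simp only: level[OF y]) simp
    then show "g1 y + g2 y = a + y"
      using that level_id(2)[OF y] by simp
  qed
  moreover have "distr M M T = M" if sum: "\<forall>y\<in>{0..1}. g1 y + g2 y = a + y"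
  proof -
    have id: "(\<lambda>x. x) \<in> borel_measurable M"
      by (simp add: M_def measurable_restrict_space1)
    \<comment> \<open>Distribution functions belong to Borel measures on the whole line, hence the codomain \<open>borel\<close>.\<close>
    have eq: "distr M borel T = distr M borel (\<lambda>x. x)"
    proof (rule cdf_unique)
      show "real_distribution (distr M borel T)"
        using prob_space.prob_space_distr[OF prob borelT] 
        by (simp add: real_distribution_def real_distribution_axioms_def)
      show "real_distribution (distr M borel (\<lambda>x. x))"
        using prob_space.prob_space_distr[OF prob id] 
        by (simp add: real_distribution_def real_distribution_axioms_def)
      show "cdf (distr M borel T) = cdf (distr M borel (\<lambda>x. x))"
      proof
        fix y :: real
        have cdf_T: "cdf (distr M borel T) y = measure M {x \<in> {0..1}. T x \<le> y}"
          unfolding cdf_def using borelT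
          by (subst measure_distr) (auto simp: space intro!: arg_cong[where f = "measure M"])
        have cdf_id: "cdf (distr M borel (\<lambda>x. x)) y = measure M {x \<in> {0..1}. x \<le> y}"
          unfolding cdf_def using id
          by (subst measure_distr) (auto simp: space intro!: arg_cong[where f = "measure M"])
        consider "y < 0" | "0 \<le> y" "y \<le> 1" | "y > 1"
      by linarith
        then show "cdf (distr M borel T) y = cdf (distr M borel (\<lambda>x. x)) y"
        proof cases
          case 1
          then have "{x \<in> {0..1}. T x \<le> y} = {x \<in> {0..1}. x \<le> y}"
            using range by fastforce
          then show ?thesis
            unfolding cdf_T cdf_id by simp
        next
          case 2
          then have y: "y \<in> {0..1}"
            by simp
          show ?thesis
            using level[OF y] level_id(1)[OF y] sum y unfolding cdf_T cdf_id by simp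
        next
          case 3
          then have "{x \<in> {0..1}. T x \<le> y} = {x \<in> {0..1}. x \<le> y}"
            using range by fastforce
          then show ?thesis
            unfolding cdf_T cdf_id by simp
        qed
      qed
    qed
    show ?thesis
    proof (rule measure_eqI)
      fix A assume "A \<in> sets (distr M M T)"
      then have A: "A \<in> sets M" "A \<in> sets borel"
        using sets.sets_into_space by (auto simp: M_def sets_restrict_space)
      have "emeasure (distr M M T) A = emeasure (distr M borel T) A"
        using A measT borelT by (simp add: emeasure_distr)
      also have "\<dots> = emeasure M A"
        using A id sets.sets_into_space[OF A(1)] unfolding eq by (simp add: emeasure_distr Int_absorb2)
      finally show "emeasure (distr M M T) A = emeasure M A" .
    qed simp
  qed
  ultimately show ?thesis
    unfolding measure_preserving_map_def using measT by (auto simp flip: M_def T_def)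
qed

text \<open>The measure identity determines the inverse of the second branch, and with it the slope; conversely
  \<open>1 - d1\<close> has values in \<open>(0, 1)\<close> because \<open>d1\<close> has.\<close>

lemma lebesgue_preserving_extension_iff:
  assumes f1: "has_inverse_branch 0 a f1 g1 d1" and a: "0 < a" "a < 1"
  shows "lebesgue_preserving_extension a f1 f2 \<longleftrightarrow>
    has_inverse_branch a 1 f2 (\<lambda>y. a + y - g1 y) (\<lambda>y. 1 - d1 y)"
proof
  assume "has_inverse_branch a 1 f2 (\<lambda>y. a + y - g1 y) (\<lambda>y. 1 - d1 y)"
  then show "lebesgue_preserving_extension a f1 f2"
    unfolding lebesgue_preserving_extension_def
    using full_branch_of_inverse_branch(1) two_branch_measure_preserving_iff[OF f1 _ a] by fastforce
next
  assume ext: "lebesgue_preserving_extension a f1 f2"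
  then obtain d2 where f2: "has_inverse_branch a 1 f2 (inv_into {a..1} f2) d2"
    unfolding lebesgue_preserving_extension_def using inverse_branch_of_full_branch a(2) by blast
  have "\<forall>y\<in>{0..1}. g1 y + inv_into {a..1} f2 y = a + y"
    using ext two_branch_measure_preserving_iff[OF f1 f2 a]
    by (simp add: lebesgue_preserving_extension_def)
  then have "inv_into {a..1} f2 y = a + y - g1 y" if "y \<in> {0..1}" for y
    using that by (simp add: algebra_simps)
  moreover have "f2 (inv_into {a..1} f2 y) = y" if "y \<in> {0..1}" for y
    using f2 that unfolding has_inverse_branch_def by blast
  ultimately have "f2 (a + y - g1 y) = y" if "y \<in> {0..1}" for y
    using that by metis
  then show "has_inverse_branch a 1 f2 (\<lambda>y. a + y - g1 y) (\<lambda>y. 1 - d1 y)"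
    using f1 unfolding has_inverse_branch_def by (auto intro!: derivative_eq_intros continuous_intros)
qed

lemma ex1_lebesgue_preserving_extension:
  assumes f1: "has_inverse_branch 0 a f1 g1 d1" and a: "0 < a" "a < 1"
  shows "\<exists>!f2. f2 \<in> extensional {a..1} \<and> lebesgue_preserving_extension a f1 f2"
proof -
  define g2 where "g2 y = a + y - g1 y" for y
  define f2 where "f2 = restrict (inv_into {0..1} g2) {a..1}"
  have ends: "g2 0 = a" "g2 1 = 1"
    using f1 by (auto simp: g2_def has_inverse_branch_def)
  have "has_inverse_branch (g2 0) (g2 1) (inv_into {0..1} g2) g2 (\<lambda>y. 1 - d1 y)"
    by (rule has_inverse_branch_inv_into)
      (use f1 in \<open>auto simp: g2_def has_inverse_branch_def intro!: derivative_eq_intros continuous_intros\<close>)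
  then have inv: "has_inverse_branch a 1 (inv_into {0..1} g2) g2 (\<lambda>y. 1 - d1 y)"
    by (simp only: ends)
  have "f2 (g2 y) = inv_into {0..1} g2 (g2 y)" if "y \<in> {0..1}" for y
    unfolding f2_def using inverse_branch_bounds[OF inv that] by simp
  then have "has_inverse_branch a 1 f2 g2 (\<lambda>y. 1 - d1 y)"
    using inv by (simp add: has_inverse_branch_def)
  then have f2: "has_inverse_branch a 1 f2 (\<lambda>y. a + y - g1 y) (\<lambda>y. 1 - d1 y)"
    unfolding g2_def .
  show ?thesis
  proof (rule ex1I[of _ f2])
    show "f2 \<in> extensional {a..1} \<and> lebesgue_preserving_extension a f1 f2"
      unfolding lebesgue_preserving_extension_iff[OF f1 a] using f2 by (simp add: f2_def)
  next
    fix h assume "h \<in> extensional {a..1} \<and> lebesgue_preserving_extension a f1 h"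
    then have h: "h \<in> extensional {a..1}"
      "has_inverse_branch a 1 h (\<lambda>y. a + y - g1 y) (\<lambda>y. 1 - d1 y)"
      unfolding lebesgue_preserving_extension_iff[OF f1 a] by auto
    show "h = f2"
    proof (rule extensionalityI[OF h(1)])
      show "f2 \<in> extensional {a..1}"
        by (simp add: f2_def)
      fix x assume "x \<in> {a..1}"
      then obtain y where "y \<in> {0..1}" "x = a + y - g1 y"
        using inverse_branch_image[OF f2] by blast
      then show "h x = f2 x"
        using f2 h(2) unfolding has_inverse_branch_def by metis
    qed
  qed
qed


section \<open>Differentiability on the circle\<close>

lemma circle_of_eq_iff: "circle_of x = circle_of y \<longleftrightarrow> x - y \<in> \<int>"
  by transfer simp

lemma unit_rep_circle_of: "unit_rep (circle_of x) = frac x"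
  by transfer simp

lemma circle_of_unit_rep: "circle_of (unit_rep p) = p"
  by transfer (simp add: frac_def)

lemma unit_rep_bounds: "0 \<le> unit_rep p" "unit_rep p < 1"
  by (transfer, simp add: frac_lt_1)+

lemma dist_circle_of: "dist (circle_of x) (circle_of y) = \<bar>x - y - of_int (round (x - y))\<bar>"
  by transfer simp

lemma dist_circle_of_le: "dist (circle_of x) (circle_of y) \<le> \<bar>x - y\<bar>"
  using round_diff_minimal[of "x - y" 0] by (simp add: dist_circle_of)

lemma ex_circle_lift_at_dist:
  obtains y where "circle_of y = q" "\<bar>y - x\<bar> = dist q (circle_of x)"
proof
  let ?k = "round (unit_rep q - x)"
  have "circle_of (unit_rep q - of_int ?k) = circle_of (unit_rep q)"
    by (simp add: circle_of_eq_iff)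
  then show "circle_of (unit_rep q - of_int ?k) = q"
    by (simp only: circle_of_unit_rep)
  show "\<bar>unit_rep q - of_int ?k - x\<bar> = dist q (circle_of x)"
    using dist_circle_of[of "unit_rep q" x] by (simp add: circle_of_unit_rep algebra_simps)
qed

lemma isCont_circle_of: "isCont circle_of x"
  unfolding continuous_at_eps_delta
  using dist_circle_of_le by (metis dist_real_def le_less_trans)

text \<open>Continuity at a point of the circle can be checked on lifts, because nearby points have lifts that are
  equally near.\<close>

lemma isCont_on_circleI:
  fixes G :: "circle \<Rightarrow> 'a::metric_space"
  assumes "isCont (\<lambda>y. G (circle_of y)) x"
  shows "isCont G (circle_of x)"
  unfolding continuous_at_eps_delta
proof (intro allI impI)
  fix e :: real assume "0 < e"
  then obtain \<delta> where \<delta>: "\<delta> > 0" "\<And>y. dist y x < \<delta> \<Longrightarrow> dist (G (circle_of y)) (G (circle_of x)) < e"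
    using assms unfolding continuous_at_eps_delta by blast
  have "dist (G q) (G (circle_of x)) < e" if "dist q (circle_of x) < \<delta>" for q
  proof -
    obtain y where "circle_of y = q" "\<bar>y - x\<bar> = dist q (circle_of x)"
      by (rule ex_circle_lift_at_dist)
    then show ?thesis
      using \<delta>(2)[of y] that by (simp add: dist_real_def)
  qed
  with \<delta>(1) show "\<exists>d>0. \<forall>q. dist q (circle_of x) < d \<longrightarrow> dist (G q) (G (circle_of x)) < e"
    by blast
qed

text \<open>A derivative at a single point is taken of a lift continuous at that point, which is enough for
  continuity, and so for measurability, of the circle map itself.\<close>

lemma has_circle_derivative_isCont:
  assumes "has_circle_derivative f D p"
  shows "isCont f p"
proof -
  obtain F x where F: "\<And>y. circle_of (F y) = f (circle_of y)" "circle_of x = p"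
    "(F has_real_derivative D) (at x)"
    using assms unfolding has_circle_derivative_def by blast
  have "isCont (\<lambda>y. circle_of (F y)) x"
    using isCont_o2[OF DERIV_isCont[OF F(3)] isCont_circle_of] .
  then show ?thesis
    using isCont_on_circleI[where G = f and x = x] unfolding F(1,2) by blast
qed

text \<open>A one-sided lift suffices to compute the derivative of a differentiable circle map: it differs from
  a differentiable lift by an integer-valued function that is continuous at \<open>x\<close> within \<open>S\<close>, hence constant
  near \<open>x\<close>. Applied on both sides of a branch point this yields the matching conditions.\<close>

lemma has_circle_derivative_within_eq:
  assumes "has_circle_derivative f D (circle_of x)"
    and F0: "(F0 has_real_derivative E) (at x within S)"
    and lift: "\<And>y. y \<in> S \<Longrightarrow> circle_of (F0 y) = f (circle_of y)"
    and x: "x \<in> S" "at x within S \<noteq> bot"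
  shows "D = E"
proof -
  obtain F x' where F: "\<And>y. circle_of (F y) = f (circle_of y)" "circle_of x' = circle_of x"
    "(F has_real_derivative D) (at x')"
    using assms(1) unfolding has_circle_derivative_def by blast
  define k where "k = x' - x"
  have k: "k \<in> \<int>"
    using F(2) by (simp add: k_def circle_of_eq_iff)
  define H where "H y = F (y + k) - F0 y" for y
  have H_int: "H y \<in> \<int>" if "y \<in> S" for y
  proof -
    have "circle_of (y + k) = circle_of y"
      using k by (simp add: circle_of_eq_iff)
    then show ?thesis
      using F(1)[of "y + k"] lift[OF that] by (simp add: H_def flip: circle_of_eq_iff)
  qed
  have "((\<lambda>y. F (y + k)) has_real_derivative D) (at x)"
    using F(3) DERIV_shift[of F D x k] by (simp add: k_def)
  then have dH: "(H has_real_derivative D - E) (at x within S)"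
    unfolding H_def using F0 has_field_derivative_at_within by (intro DERIV_diff) blast+
  then have "(H \<longlongrightarrow> H x) (at x within S)"
    using DERIV_continuous by (simp add: continuous_within) blast
  then have "\<forall>\<^sub>F y in at x within S. dist (H y) (H x) < 1"
    by (rule tendstoD) simp
  moreover have "\<forall>\<^sub>F y in at x within S. y \<in> S"
    by (simp add: eventually_at_filter)
  ultimately have "\<forall>\<^sub>F y in at x within S. (H y - H x) / (y - x) = 0"
  proof eventually_elim
    case (elim y)
    then show ?case
      using Ints_nonzero_abs_less1[of "H y - H x"] H_int x(1) by (auto simp: dist_real_def)
  qed
  then have "((\<lambda>y. (H y - H x) / (y - x)) \<longlongrightarrow> 0) (at x within S)"
    by (rule tendsto_eventually)
  with dH have "D - E = 0"
    unfolding has_field_derivative_iff using x(2) tendsto_unique by blast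
  then show ?thesis
    by simp
qed

text \<open>Away from \<open>x\<close> any choice of lift will do, so a local lift extends by representatives in \<open>[0, 1)\<close>.\<close>

lemma has_circle_derivative_local:
  assumes "(F has_real_derivative D) (at x)"
    and "\<forall>\<^sub>F y in nhds x. circle_of (F y) = f (circle_of y)"
  shows "has_circle_derivative f D (circle_of x)"
  unfolding has_circle_derivative_def
proof (intro exI conjI allI)
  let ?F = "\<lambda>y. if circle_of (F y) = f (circle_of y) then F y else unit_rep (f (circle_of y))"
  show "circle_of (?F y) = f (circle_of y)" for y
    by (simp add: circle_of_unit_rep)
  show "(?F has_real_derivative D) (at x)"
    using assms(1)
    by (rule DERIV_cong_ev[OF refl _ refl, THEN iffD2, rotated])
      (use assms(2) in \<open>auto elim: eventually_mono\<close>)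
qed simp

text \<open>Two one-sided lifts agree at \<open>x\<close> up to an integer; after shifting one of them they join to a lift
  near \<open>x\<close>.\<close>

lemma has_circle_derivative_glue:
  assumes "u < x" "x < v"
    and F1: "(F1 has_real_derivative D) (at x within {u..x})"
      "\<And>y. y \<in> {u..x} \<Longrightarrow> circle_of (F1 y) = f (circle_of y)"
    and F2: "(F2 has_real_derivative D) (at x within {x..v})"
      "\<And>y. y \<in> {x..v} \<Longrightarrow> circle_of (F2 y) = f (circle_of y)"
  shows "has_circle_derivative f D (circle_of x)"
proof (rule has_circle_derivative_local)
  let ?c = "F1 x - F2 x"
  let ?F = "\<lambda>y. if y \<le> x then F1 y else F2 y + ?c"
  have c: "?c \<in> \<int>"
    using F1(2)[of x] F2(2)[of x] assms(1,2) by (simp flip: circle_of_eq_iff)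
  have "((\<lambda>y. (?F y - ?F x) / (y - x)) \<longlongrightarrow> D) (at_left x)"
    using F1(1) unfolding has_field_derivative_iff at_within_Icc_at_left[OF assms(1)]
    by (rule Lim_transform_eventually) (simp add: eventually_at_filter)
  moreover have "((\<lambda>y. (?F y - ?F x) / (y - x)) \<longlongrightarrow> D) (at_right x)"
    using F2(1) unfolding has_field_derivative_iff at_within_Icc_at_right[OF assms(2)]
    by (rule Lim_transform_eventually) (simp add: eventually_at_filter)
  ultimately show "(?F has_real_derivative D) (at x)"
    unfolding has_field_derivative_iff by (rule filterlim_split_at)
  have "\<forall>\<^sub>F y in nhds x. y \<in> {u<..<v}"
    using assms(1,2) by (intro eventually_nhds_in_open) auto
  then show "\<forall>\<^sub>F y in nhds x. circle_of (?F y) = f (circle_of y)"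
  proof eventually_elim
    case (elim y)
    have "circle_of (F2 y + ?c) = circle_of (F2 y)"
      using c by (simp add: circle_of_eq_iff)
    then show ?case
      using elim F1(2)[of y] F2(2)[of y] by auto
  qed
qed

lemma isCont_frac_periodic:
  fixes E :: "real \<Rightarrow> real"
  assumes "continuous_on {0..1} E" "E 0 = E 1"
  shows "isCont (\<lambda>x. E (frac x)) x"
proof -
  \<comment> \<open>On each integer interval the function is a translate of \<open>E\<close>; at the right endpoint this uses \<open>E 0 = E 1\<close>.\<close>
  have *: "continuous_on {of_int k..of_int k + 1} (\<lambda>x. E (frac x))" for k :: int
  proof (rule continuous_on_eq)
    show "continuous_on {of_int k..of_int k + 1} (\<lambda>x. E (x - of_int k))"
      by (rule continuous_on_compose2[OF assms(1)]) (auto intro!: continuous_intros)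
    fix x :: real assume x: "x \<in> {of_int k..of_int k + 1}"
    show "E (x - of_int k) = E (frac x)"
    proof (cases "x = of_int k + 1")
      case True
      then have "frac x = 0"
        by (metis frac_of_int of_int_1 of_int_add)
      then show ?thesis
        using True assms(2) by simp
    next
      case False
      then have "frac x = x - of_int k"
        using x by (simp add: frac_unique_iff)
      then show ?thesis
        by simp
    qed
  qed
  let ?k = "of_int \<lfloor>x\<rfloor> :: real"
  have "continuous_on ({?k - 1..?k} \<union> {?k..?k + 1}) (\<lambda>x. E (frac x))"
    using *[of "\<lfloor>x\<rfloor> - 1"] *[of "\<lfloor>x\<rfloor>"] by (intro continuous_on_closed_Un) auto
  moreover have "{?k - 1..?k} \<union> {?k..?k + 1} = {?k - 1..?k + 1}"
    by auto
  ultimately have "continuous_on {?k - 1..?k + 1} (\<lambda>x. E (frac x))"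
    by (simp only:)
  moreover have "x \<in> interior {?k - 1..?k + 1}"
    by (simp add: interior_atLeastAtMost_real) linarith
  ultimately show ?thesis
    by (rule continuous_on_interior)
qed

section \<open>Circle maps with two full branches\<close>

context
  fixes a :: real and f1 g1 d1 f2 g2 d2 :: "real \<Rightarrow> real"
  assumes f1: "has_inverse_branch 0 a f1 g1 d1"
    and f2: "has_inverse_branch a 1 f2 g2 d2"
    and a: "0 < a" "a < 1"
begin

lemma induced_lift_left:
  assumes "y \<in> {0..a}"
  shows "circle_of (f1 y) = induced_circle_map (two_branch_map a f1 f2) (circle_of y)"
proof -
  have "frac y = y"
    using assms a by (simp add: frac_eq)
  then show ?thesis
    using assms by (simp add: induced_circle_map_def unit_rep_circle_of two_branch_map_def)
qed

lemma induced_lift_right: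
  assumes "y \<in> {a..1}"
  shows "circle_of (f2 y) = induced_circle_map (two_branch_map a f1 f2) (circle_of y)"
proof -
  consider "y = a" | "y = 1" | "a < y" "y < 1"
    using assms by fastforce
  then show ?thesis
  proof cases
    case 1
    then show ?thesis
      using a full_branch_endpoints[OF f1] full_branch_endpoints[OF f2]
      by (simp add: induced_circle_map_def unit_rep_circle_of two_branch_map_def frac_eq circle_of_eq_iff)
  next
    case 2
    then show ?thesis
      using a full_branch_endpoints[OF f1] full_branch_endpoints[OF f2]
      by (simp add: induced_circle_map_def unit_rep_circle_of two_branch_map_def circle_of_eq_iff)
  next
    case 3
    then have "frac y = y"
      using a by (simp add: frac_eq)
    with 3 show ?thesis
      by (simp add: induced_circle_map_def unit_rep_circle_of two_branch_map_def)
  qed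
qed

lemma matching_imp_circle_derivative:
  assumes match: "d1 1 = d2 0" "d1 0 = d2 1" and x: "0 \<le> x" "x < 1"
  shows "has_circle_derivative (induced_circle_map (two_branch_map a f1 f2))
    (if x \<le> a then 1 / d1 (f1 x) else 1 / d2 (f2 x)) (circle_of x)"
proof -
  let ?f = "induced_circle_map (two_branch_map a f1 f2)"
  note der1 = full_branch_of_inverse_branch(2)[OF f1]
  note der2 = full_branch_of_inverse_branch(2)[OF f2]
  consider "x = 0" | "0 < x" "x < a" | "x = a" | "a < x"
    using x by linarith
  then show ?thesis
  proof cases
    case 1
    \<comment> \<open>At the point 0 of the circle the lift is taken around 1: \<open>f2\<close> on the left and a translate of \<open>f1\<close> on the right.\<close>
    have "has_circle_derivative ?f (1 / d1 0) (circle_of 1)"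
    proof (rule has_circle_derivative_glue[OF a(2)])
      show "(f2 has_real_derivative 1 / d1 0) (at 1 within {a..1})"
        using der2[of 1] a full_branch_endpoints[OF f2] match by simp
      show "(1::real) < 1 + a"
        using a by simp
      have "(\<lambda>y. y - 1) ` {1..1 + a} \<subseteq> {0..a}"
        by auto
      then have "(f1 has_real_derivative 1 / d1 0) (at (1 - 1) within (\<lambda>y. y - 1) ` {1..1 + a})"
        using der1[of 0] a full_branch_endpoints[OF f1] by (auto intro: DERIV_subset)
      then have "(f1 \<circ> (\<lambda>y. y - 1) has_real_derivative 1 / d1 0 * 1) (at 1 within {1..1 + a})"
        by (rule DERIV_image_chain) (auto intro!: derivative_eq_intros)
      then show "((\<lambda>y. f1 (y - 1)) has_real_derivative 1 / d1 0) (at 1 within {1..1 + a})"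
        by (simp add: o_def)
      show "circle_of (f1 (y - 1)) = ?f (circle_of y)" if "y \<in> {1..1 + a}" for y
      proof -
        have "circle_of (y - 1) = circle_of y"
          by (simp add: circle_of_eq_iff)
        then show ?thesis
          using induced_lift_left[of "y - 1"] that by simp
      qed
    qed (rule induced_lift_right)
    moreover have "circle_of 1 = circle_of x"
      using 1 by (simp add: circle_of_eq_iff)
    ultimately show ?thesis
      using 1 a full_branch_endpoints[OF f1] by simp
  next
    case 2
    have "has_circle_derivative ?f (1 / d1 (f1 x)) (circle_of x)"
      by (rule has_circle_derivative_glue[OF 2, where ?F1.0 = f1 and ?F2.0 = f1])
        (use 2 in \<open>auto intro!: induced_lift_left DERIV_subset[OF der1]\<close>)
    then show ?thesis
      using 2 by simp
  next
    case 3
    have "has_circle_derivative ?f (1 / d1 1) (circle_of a)"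
      by (rule has_circle_derivative_glue[OF a, where ?F1.0 = f1 and ?F2.0 = f2])
        (use a der1[of a] der2[of a] full_branch_endpoints[OF f1] full_branch_endpoints[OF f2] match
          in \<open>auto intro!: induced_lift_left induced_lift_right\<close>)
    then show ?thesis
      using 3 full_branch_endpoints[OF f1] by simp
  next
    case 4
    have "has_circle_derivative ?f (1 / d2 (f2 x)) (circle_of x)"
      by (rule has_circle_derivative_glue[OF 4 x(2), where ?F1.0 = f2 and ?F2.0 = f2])
        (use 4 x in \<open>auto intro!: induced_lift_right DERIV_subset[OF der2]\<close>)
    then show ?thesis
      using 4 by simp
  qed
qed

lemma circle_deriv_two_branch:
  assumes "d1 1 = d2 0" "d1 0 = d2 1"
  shows "circle_deriv (induced_circle_map (two_branch_map a f1 f2)) p =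
    (if unit_rep p \<le> a then 1 / d1 (f1 (unit_rep p)) else 1 / d2 (f2 (unit_rep p)))"
  unfolding circle_deriv_def
  using matching_imp_circle_derivative[OF assms unit_rep_bounds, of p] has_circle_derivative_unique
  unfolding circle_of_unit_rep by blast

text \<open>The derivatives at the endpoints of the branches are reciprocals of \<open>d1\<close>, \<open>d2\<close> at 0 and 1, so the two
  equations say that one-sided derivatives match at \<open>a\<close> and at \<open>0 = 1\<close>.\<close>

lemma circle_C1_two_branch_iff:
  "circle_C1 (induced_circle_map (two_branch_map a f1 f2)) \<longleftrightarrow> d1 1 = d2 0 \<and> d1 0 = d2 1"
proof
  let ?f = "induced_circle_map (two_branch_map a f1 f2)"
  note der1 = full_branch_of_inverse_branch(2)[OF f1]
  note der2 = full_branch_of_inverse_branch(2)[OF f2]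
  note ends = full_branch_endpoints[OF f1] full_branch_endpoints[OF f2]
  assume C1: "circle_C1 ?f"
  obtain D where "has_circle_derivative ?f D (circle_of a)"
    using C1 by (auto simp: circle_C1_def)
  then have "D = 1 / d1 (f1 a)" "D = 1 / d2 (f2 a)"
    using has_circle_derivative_within_eq[OF _ der1 induced_lift_left, of D a]
      has_circle_derivative_within_eq[OF _ der2 induced_lift_right, of D a] a
    by (auto simp: trivial_limit_within islimpt_Icc)
  then have 1: "d1 1 = d2 0"
    using ends by simp
  obtain D where D: "has_circle_derivative ?f D (circle_of 0)"
    using C1 by (auto simp: circle_C1_def)
  have "circle_of 1 = circle_of 0"
    by (simp add: circle_of_eq_iff)
  with D have "D = 1 / d1 (f1 0)" "D = 1 / d2 (f2 1)"
    using has_circle_derivative_within_eq[OF _ der1 induced_lift_left, of D 0]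
      has_circle_derivative_within_eq[OF _ der2 induced_lift_right, of D 1] a
    by (auto simp: trivial_limit_within islimpt_Icc)
  with 1 show "d1 1 = d2 0 \<and> d1 0 = d2 1"
    using ends by simp
next
  let ?f = "induced_circle_map (two_branch_map a f1 f2)"
  note ends = full_branch_endpoints[OF f1] full_branch_endpoints[OF f2]
  let ?E = "\<lambda>x. if x \<le> a then 1 / d1 (f1 x) else 1 / d2 (f2 x)"
  assume match: "d1 1 = d2 0 \<and> d1 0 = d2 1"
  have "continuous_on ({0..a} \<union> {a..1}) ?E"
    using full_branch_slope_continuous_on[OF f1] full_branch_slope_continuous_on[OF f2] ends match
    by (intro continuous_on_If) auto
  moreover have "{0..a} \<union> {a..1} = {0..1}"
    using a by auto
  ultimately have E: "continuous_on {0..1} ?E"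
    by (simp only:)
  have "?E 0 = ?E 1"
    using a ends match by simp
  have "isCont (circle_deriv ?f) p" for p
  proof -
    have "isCont (\<lambda>y. circle_deriv ?f (circle_of y)) (unit_rep p)"
      unfolding circle_deriv_two_branch[OF conjunct1[OF match] conjunct2[OF match]] unit_rep_circle_of
      by (rule isCont_frac_periodic[OF E \<open>?E 0 = ?E 1\<close>])
    then show ?thesis
      using isCont_on_circleI[where G = "circle_deriv ?f" and x = "unit_rep p"]
      by (simp add: circle_of_unit_rep)
  qed
  moreover have "\<exists>D. has_circle_derivative ?f D p" for p
    using matching_imp_circle_derivative[OF _ _ unit_rep_bounds, of p] match
    unfolding circle_of_unit_rep by blast
  ultimately show "circle_C1 ?f"
    unfolding circle_C1_def by (blast intro: continuous_at_imp_continuous_on)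
qed

end

text \<open>With \<open>d2 = 1 - d1\<close> the two matching conditions become the same equation.\<close>

lemma extension_circle_C1_iff:
  assumes f1: "has_inverse_branch 0 a f1 g1 d1" and a: "0 < a" "a < 1"
    and ext: "lebesgue_preserving_extension a f1 f2"
  shows "circle_C1 (induced_circle_map (two_branch_map a f1 f2)) \<longleftrightarrow> d1 0 + d1 1 = 1"
proof -
  have "d1 1 = 1 - d1 0 \<and> d1 0 = 1 - d1 1 \<longleftrightarrow> d1 0 + d1 1 = 1"
    by linarith
  then show ?thesis
    unfolding circle_C1_two_branch_iff[OF f1 lebesgue_preserving_extension_iff[OF f1 a, THEN iffD1, OF ext] a] .
qed

lemma slope_condition_iff:
  assumes f1: "has_inverse_branch 0 a f1 g1 d1" and a: "0 < a"
  shows "vector_derivative f1 (at 0 within {0..a}) =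
      vector_derivative f1 (at a within {0..a}) / (vector_derivative f1 (at a within {0..a}) - 1)
    \<longleftrightarrow> d1 0 + d1 1 = 1"
proof -
  note der1 = full_branch_of_inverse_branch(2)[OF f1]
  have der: "vector_derivative f1 (at 0 within {0..a}) = 1 / d1 0"
    "vector_derivative f1 (at a within {0..a}) = 1 / d1 1"
    using vector_derivative_Icc[OF a _ der1, of 0] vector_derivative_Icc[OF a _ der1, of a] a
      full_branch_endpoints[OF f1] by auto
  have "0 < d1 1" "d1 1 < 1"
    using f1 by (auto simp: has_inverse_branch_def)
  then have "1 / d1 1 / (1 / d1 1 - 1) = 1 / (1 - d1 1)"
    by (simp add: divide_simps)
  moreover have "1 / d1 0 = 1 / (1 - d1 1) \<longleftrightarrow> d1 0 = 1 - d1 1"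
    by simp
  ultimately show ?thesis
    unfolding der by (auto simp: algebra_simps)
qed

section \<open>Concave moduli of continuity\<close>

text \<open>Concavity along the segment from 0, where \<open>\<omega>\<close> vanishes. Positivity, control under dilations and
  subadditivity all follow from this inequality.\<close>

lemma concave_moduli_contraction:
  assumes "\<omega> \<in> concave_moduli" "0 \<le> u" "u \<le> 1" "0 \<le> t"
  shows "u * \<omega> t \<le> \<omega> (u * t)"
  using concave_onD[of "{0..}" \<omega> u 0 t] assms by (simp add: concave_moduli_def)

lemma concave_moduli_nonneg: "\<omega> \<in> concave_moduli \<Longrightarrow> 0 \<le> t \<Longrightarrow> 0 \<le> \<omega> t"
  by (simp add: concave_moduli_def)

lemma concave_moduli_mono: "\<omega> \<in> concave_moduli \<Longrightarrow> 0 \<le> s \<Longrightarrow> s \<le> t \<Longrightarrow> \<omega> s \<le> \<omega> t"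
  using mono_onD[of "{0..}" \<omega> s t] by (simp add: concave_moduli_def)

lemma concave_moduli_pos:
  assumes \<omega>: "\<omega> \<in> concave_moduli" and "0 < t"
  shows "0 < \<omega> t"
proof -
  obtain s where s: "0 \<le> s" "\<omega> s \<noteq> 0" and "\<omega> 0 = 0"
    using \<omega> by (auto simp: concave_moduli_def)
  then have s: "0 < s" "0 < \<omega> s"
    using concave_moduli_nonneg[OF \<omega>, of s] by (auto simp: less_le)
  show ?thesis
  proof (cases "s \<le> t")
    case True
    then show ?thesis
      using concave_moduli_mono[OF \<omega>, of s t] s by simp
  next
    case False
    then have "0 < t / s * \<omega> s" "t / s * \<omega> s \<le> \<omega> t"
      using concave_moduli_contraction[OF \<omega>, of "t / s" s] s \<open>0 < t\<close> by auto
    then show ?thesis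
      by linarith
  qed
qed

lemma concave_moduli_dilation:
  assumes "\<omega> \<in> concave_moduli" "1 \<le> L" "0 \<le> t"
  shows "\<omega> (L * t) \<le> L * \<omega> t"
  using concave_moduli_contraction[OF assms(1), of "1 / L" "L * t"] assms(2,3) by (simp add: field_simps)

lemma concave_moduli_subadditive:
  assumes \<omega>: "\<omega> \<in> concave_moduli" and "0 \<le> s" "0 \<le> t"
  shows "\<omega> (s + t) \<le> \<omega> s + \<omega> t"
proof (cases "s + t = 0")
  case True
  then show ?thesis
    using assms concave_moduli_nonneg[OF \<omega>, of 0] by (simp add: add_nonneg_eq_0_iff)
next
  case False
  then have st: "0 < s + t"
    using assms by linarith
  have "s / (s + t) * \<omega> (s + t) \<le> \<omega> s" "t / (s + t) * \<omega> (s + t) \<le> \<omega> t"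
    using concave_moduli_contraction[OF \<omega>, of "s / (s + t)" "s + t"]
      concave_moduli_contraction[OF \<omega>, of "t / (s + t)" "s + t"] st assms(2,3) by auto
  moreover have "s / (s + t) * \<omega> (s + t) + t / (s + t) * \<omega> (s + t) = \<omega> (s + t)"
    using st by (simp add: add_divide_distrib[symmetric] distrib_right[symmetric])
  ultimately show ?thesis
    by linarith
qed

lemma concave_moduli_diff:
  assumes \<omega>: "\<omega> \<in> concave_moduli" and "0 \<le> s" "0 \<le> t"
  shows "\<bar>\<omega> s - \<omega> t\<bar> \<le> \<omega> \<bar>s - t\<bar>"
proof -
  have *: "\<bar>\<omega> s - \<omega> t\<bar> \<le> \<omega> \<bar>s - t\<bar>" if "0 \<le> s" "s \<le> t" for s t
    using concave_moduli_subadditive[OF \<omega>, of s "t - s"] concave_moduli_mono[OF \<omega> that]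
      concave_moduli_nonneg[OF \<omega>, of 0] that
    by (simp add: abs_if)
  show ?thesis
    using *[of s t] *[of t s] assms(2,3) by (cases "s \<le> t") (auto simp: abs_minus_commute)
qed

text \<open>The derivative of the branch at \<open>x\<close> is \<open>1 / d (f x)\<close>. Since \<open>d \<ge> q\<close>, the branch is Lipschitz with
  constant \<open>1 / q\<close> and the reciprocal is Lipschitz with constant \<open>1 / q\<^sup>2\<close>, whence the exponent 3.\<close>

lemma full_branch_slope_modulus:
  assumes f: "has_inverse_branch u v f g d" and \<omega>: "\<omega> \<in> concave_moduli"
    and q: "0 < q" "q \<le> 1" "\<And>y. y \<in> {0..1} \<Longrightarrow> q \<le> d y"
    and K: "0 \<le> K" "\<And>s t. s \<in> {0..1} \<Longrightarrow> t \<in> {0..1} \<Longrightarrow> \<bar>d s - d t\<bar> \<le> K * \<omega> \<bar>s - t\<bar>"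
    and xy: "x \<in> {u..v}" "y \<in> {u..v}"
  shows "\<bar>1 / d (f x) - 1 / d (f y)\<bar> \<le> K / q ^ 3 * \<omega> \<bar>x - y\<bar>"
proof -
  note range = full_branch_range(1)[OF f]
  have dq: "q \<le> d (f z)" if "z \<in> {u..v}" for z
    using q(3) range[OF that] by blast
  have "norm (f x - f y) \<le> 1 / q * norm (x - y)"
  proof (rule field_differentiable_bound[where S = "{u..v}"])
    show "(f has_real_derivative 1 / d (f z)) (at z within {u..v})" if "z \<in> {u..v}" for z
      by (rule full_branch_of_inverse_branch(2)[OF f that])
    show "norm (1 / d (f z)) \<le> 1 / q" if "z \<in> {u..v}" for z
      using dq[OF that] q(1) by (simp add: frac_le)
  qed (use xy in auto)
  then have "\<omega> \<bar>f x - f y\<bar> \<le> \<omega> (1 / q * \<bar>x - y\<bar>)"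
    by (intro concave_moduli_mono[OF \<omega>]) auto
  also have "\<dots> \<le> 1 / q * \<omega> \<bar>x - y\<bar>"
    by (rule concave_moduli_dilation[OF \<omega>]) (use q in auto)
  finally have \<omega>f: "\<omega> \<bar>f x - f y\<bar> \<le> 1 / q * \<omega> \<bar>x - y\<bar>" .
  have "\<bar>1 / d (f x) - 1 / d (f y)\<bar> = \<bar>d (f x) - d (f y)\<bar> / (d (f x) * d (f y))"
    using dq[OF xy(1)] dq[OF xy(2)] q(1) by (simp add: divide_simps abs_minus_commute abs_mult)
  also have "\<dots> \<le> \<bar>d (f x) - d (f y)\<bar> / (q * q)"
    using dq[OF xy(1)] dq[OF xy(2)] q(1) by (intro divide_left_mono mult_mono mult_pos_pos) auto
  also have "\<dots> \<le> (K * (1 / q * \<omega> \<bar>x - y\<bar>)) / (q * q)"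
  proof (rule divide_right_mono)
    have "\<bar>d (f x) - d (f y)\<bar> \<le> K * \<omega> \<bar>f x - f y\<bar>"
      by (rule K(2)) (use range xy in auto)
    also have "\<dots> \<le> K * (1 / q * \<omega> \<bar>x - y\<bar>)"
      by (rule mult_left_mono[OF \<omega>f K(1)])
    finally show "\<bar>d (f x) - d (f y)\<bar> \<le> K * (1 / q * \<omega> \<bar>x - y\<bar>)" .
  qed (use q in auto)
  also have "\<dots> = K / q ^ 3 * \<omega> \<bar>x - y\<bar>"
    by (simp add: power3_eq_cube)
  finally show ?thesis .
qed

text \<open>Points on different sides of \<open>w\<close> are compared through \<open>w\<close>. This carries the estimates for the two
  branches across the break point between them.\<close>

lemma modulus_bound_join:
  fixes E :: "real \<Rightarrow> real"
  assumes \<omega>: "\<omega> \<in> concave_moduli" and "0 \<le> C"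
    and l: "\<And>x y. x \<in> {u..w} \<Longrightarrow> y \<in> {u..w} \<Longrightarrow> \<bar>E x - E y\<bar> \<le> C * \<omega> \<bar>x - y\<bar>"
    and r: "\<And>x y. x \<in> {w..v} \<Longrightarrow> y \<in> {w..v} \<Longrightarrow> \<bar>E x - E y\<bar> \<le> C * \<omega> \<bar>x - y\<bar>"
    and xy: "x \<in> {u..v}" "y \<in> {u..v}"
  shows "\<bar>E x - E y\<bar> \<le> 2 * C * \<omega> \<bar>x - y\<bar>"
proof -
  have *: "\<bar>E x - E y\<bar> \<le> 2 * C * \<omega> \<bar>x - y\<bar>" if "u \<le> x" "x \<le> y" "y \<le> v" for x y
  proof -
    have nn: "0 \<le> C * \<omega> \<bar>x - y\<bar>"
      using concave_moduli_nonneg[OF \<omega>, of "\<bar>x - y\<bar>"] \<open>0 \<le> C\<close> by simp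
    consider "y \<le> w" | "w \<le> x" | "x \<le> w" "w \<le> y"
      by linarith
    then show ?thesis
    proof cases
      case 1
      then show ?thesis
        using l[of x y] that nn by simp
    next
      case 2
      then show ?thesis
        using r[of x y] that nn by simp
    next
      case 3
      have "\<bar>E x - E w\<bar> \<le> C * \<omega> \<bar>x - w\<bar>" "\<bar>E w - E y\<bar> \<le> C * \<omega> \<bar>w - y\<bar>"
        using l[of x w] r[of w y] 3 that by auto
      moreover have "C * \<omega> \<bar>x - w\<bar> \<le> C * \<omega> \<bar>x - y\<bar>" "C * \<omega> \<bar>w - y\<bar> \<le> C * \<omega> \<bar>x - y\<bar>"
        using 3 \<open>0 \<le> C\<close> by (auto intro!: mult_left_mono concave_moduli_mono[OF \<omega>])
      ultimately show ?thesis
        by linarith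
    qed
  qed
  show ?thesis
    using *[of x y] *[of y x] xy by (cases "x \<le> y") (auto simp: abs_minus_commute)
qed

lemma dist_circle_of_cases:
  assumes "0 \<le> x" "x \<le> y" "y < 1"
  obtains "dist (circle_of x) (circle_of y) = y - x"
  | "dist (circle_of x) (circle_of y) = x + (1 - y)"
proof -
  have "round (y - x) = 0 \<or> round (y - x) = 1"
  proof -
    have "-1 < round (y - x)" "round (y - x) < 2"
      using assms of_int_round_gt[of "y - x"] of_int_round_le[of "y - x"] by linarith+
    then show ?thesis
      by linarith
  qed
  then show thesis
    using that assms dist_circle_of[of y x] by (auto simp: dist_commute)
qed

text \<open>Either the arc from \<open>p\<close> to \<open>r\<close> realising the distance stays inside \<open>[0, 1)\<close>, or it passes through
  \<open>0 = 1\<close> and the bound is the sum over its two parts.\<close>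

lemma periodic_modulus_bound:
  fixes E :: "real \<Rightarrow> real"
  assumes \<omega>: "\<omega> \<in> concave_moduli" and "0 \<le> C"
    and E: "\<And>x y. x \<in> {0..1} \<Longrightarrow> y \<in> {0..1} \<Longrightarrow> \<bar>E x - E y\<bar> \<le> C * \<omega> \<bar>x - y\<bar>"
    and "E 0 = E 1"
  shows "\<bar>E (unit_rep p) - E (unit_rep r)\<bar> \<le> 2 * C * \<omega> (dist p r)"
proof -
  have *: "\<bar>E x - E y\<bar> \<le> 2 * C * \<omega> (dist (circle_of x) (circle_of y))"
    if xy: "0 \<le> x" "x \<le> y" "y < 1" for x y
  proof (rule dist_circle_of_cases[OF xy])
    assume d: "dist (circle_of x) (circle_of y) = y - x"
    have "0 \<le> C * \<omega> (y - x)"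
      using concave_moduli_nonneg[OF \<omega>, of "y - x"] \<open>0 \<le> C\<close> xy by simp
    then show ?thesis
      using E[of x y] xy d by (simp add: abs_minus_commute)
  next
    assume d: "dist (circle_of x) (circle_of y) = x + (1 - y)"
    have "\<bar>E x - E 0\<bar> \<le> C * \<omega> x" "\<bar>E 1 - E y\<bar> \<le> C * \<omega> (1 - y)"
      using E[of x 0] E[of 1 y] xy by auto
    moreover have "C * \<omega> x \<le> C * \<omega> (x + (1 - y))" "C * \<omega> (1 - y) \<le> C * \<omega> (x + (1 - y))"
      using xy \<open>0 \<le> C\<close> by (auto intro!: mult_left_mono concave_moduli_mono[OF \<omega>])
    ultimately show ?thesis
      unfolding d using \<open>E 0 = E 1\<close> by linarith
  qed
  show ?thesis
    using *[of "unit_rep p" "unit_rep r"] *[of "unit_rep r" "unit_rep p"] unit_rep_bounds[of p]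
      unit_rep_bounds[of r]
    by (cases "unit_rep p \<le> unit_rep r") (auto simp: circle_of_unit_rep abs_minus_commute dist_commute)
qed

lemma canonical_modulus_le:
  fixes \<rho> :: "'a::metric_space \<Rightarrow> real"
  assumes "0 < t" "\<And>x y. dist x y < t \<Longrightarrow> \<bar>\<rho> x - \<rho> y\<bar> \<le> B"
  shows "canonical_modulus \<rho> t \<le> B"
proof -
  have "dist undefined (undefined::'a) < t"
    using assms(1) by simp
  then have "{\<bar>\<rho> x - \<rho> y\<bar> | x y. dist x y < t} \<noteq> {}"
    by blast
  then have "Sup {\<bar>\<rho> x - \<rho> y\<bar> | x y. dist x y < t} \<le> B"
    by (rule cSup_least) (use assms(2) in blast)
  then show ?thesis
    using assms(1) by (simp add: canonical_modulus_def)
qed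

lemma le_canonical_modulus:
  fixes \<rho> :: "'a::metric_space \<Rightarrow> real"
  assumes "\<And>x y. dist x y < t \<Longrightarrow> \<bar>\<rho> x - \<rho> y\<bar> \<le> B" "dist x y < t"
  shows "\<bar>\<rho> x - \<rho> y\<bar> \<le> canonical_modulus \<rho> t"
proof -
  have "bdd_above {\<bar>\<rho> x - \<rho> y\<bar> | x y. dist x y < t}"
    by (rule bdd_aboveI[where M = B]) (use assms(1) in blast)
  then have "\<bar>\<rho> x - \<rho> y\<bar> \<le> Sup {\<bar>\<rho> x - \<rho> y\<bar> | x y. dist x y < t}"
    by (rule cSup_upper[rotated]) (use assms(2) in blast)
  moreover have "0 < t"
    using assms(2) zero_le_dist[of x y] by linarith
  ultimately show ?thesis
    by (simp add: canonical_modulus_def)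
qed

section \<open>Lebesgue measure on the circle\<close>

lemma borel_measurable_circle_of: "circle_of \<in> borel \<rightarrow>\<^sub>M borel"
  by (intro borel_measurable_continuous_onI continuous_at_imp_continuous_on ballI isCont_circle_of)

lemma borel_measurable_circle_C1: "circle_C1 f \<Longrightarrow> f \<in> borel \<rightarrow>\<^sub>M borel"
  unfolding circle_C1_def
  by (blast intro: borel_measurable_continuous_onI continuous_at_imp_continuous_on
    has_circle_derivative_isCont)

text \<open>The closed unit interval may replace the half-open one, since a point is a null set. The interval
  maps are defined on the closed one.\<close>

lemma circle_lebesgue_eq_distr:
  "circle_lebesgue = distr (restrict_space lborel {0..1}) borel circle_of"
proof (rule measure_eqI)
  fix A assume "A \<in> sets circle_lebesgue"
  then have A: "A \<in> sets borel"
    by (simp add: circle_lebesgue_def)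
  have vim: "circle_of -` A \<in> sets borel"
    using measurable_sets[OF borel_measurable_circle_of A] by simp
  have push: "emeasure (distr (restrict_space lborel S) borel circle_of) A = emeasure lborel (circle_of -` A \<inter> S)"
    if "S \<in> sets borel" for S
    using that A borel_measurable_circle_of vim
    by (simp add: emeasure_distr measurable_restrict_space1 space_restrict_space emeasure_restrict_space)
  have "AE x in lborel. x \<noteq> (1::real)"
    by (rule AE_lborel_singleton)
  then have "emeasure lborel (circle_of -` A \<inter> {0..<1}) = emeasure lborel (circle_of -` A \<inter> {0..1})"
    by (intro emeasure_eq_AE) (use vim in \<open>auto elim: eventually_mono\<close>)
  then show "emeasure circle_lebesgue A = emeasure (distr (restrict_space lborel {0..1}) borel circle_of) A"
    unfolding circle_lebesgue_def by (simp add: push)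
qed (simp add: circle_lebesgue_def)

lemma measure_preserving_induced_circle_map:
  assumes T: "measure_preserving_map (restrict_space lborel {0..1}) T"
    and meas: "induced_circle_map T \<in> borel \<rightarrow>\<^sub>M borel"
  shows "measure_preserving_map circle_lebesgue (induced_circle_map T)"
proof -
  let ?M = "restrict_space lborel {0..1::real}"
  let ?f = "induced_circle_map T"
  have sets: "sets circle_lebesgue = sets borel"
    by (simp add: circle_lebesgue_def)
  have circ: "circle_of \<in> ?M \<rightarrow>\<^sub>M borel"
    using borel_measurable_circle_of by (simp add: measurable_restrict_space1)
  have Tm: "T \<in> ?M \<rightarrow>\<^sub>M ?M" and Td: "distr ?M ?M T = ?M"
    using T by (auto simp: measure_preserving_map_def)
  have "distr circle_lebesgue circle_lebesgue ?f = distr circle_lebesgue borel ?f"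
    by (rule distr_cong) (simp_all add: sets)
  also have "\<dots> = distr ?M borel (?f \<circ> circle_of)"
    unfolding circle_lebesgue_eq_distr by (rule distr_distr[OF meas circ])
  also have "\<dots> = distr ?M borel (circle_of \<circ> T)"
  proof (rule distr_cong_AE)
    have "AE x in lborel. x \<noteq> (1::real)"
      by (rule AE_lborel_singleton)
    then have "AE x in ?M. x \<in> {0..1} \<and> x \<noteq> 1"
      by (subst AE_restrict_space_iff) (auto elim: eventually_mono)
    then show "AE x in ?M. (?f \<circ> circle_of) x = (circle_of \<circ> T) x"
    proof eventually_elim
      case (elim x)
      then have "frac x = x"
        by (simp add: frac_eq)
      then show ?case
        by (simp add: induced_circle_map_def unit_rep_circle_of)
    qed
  qed (use meas circ Tm in \<open>auto intro: measurable_comp\<close>)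
  also have "\<dots> = distr (distr ?M ?M T) borel circle_of"
    by (rule distr_distr[symmetric, OF circ Tm])
  also have "\<dots> = circle_lebesgue"
    unfolding Td circle_lebesgue_eq_distr ..
  finally have "distr circle_lebesgue circle_lebesgue ?f = circle_lebesgue" .
  then show ?thesis
    unfolding measure_preserving_map_def using meas by (simp add: measurable_cong_sets[OF sets sets])
qed

lemma prob_space_circle_lebesgue: "prob_space circle_lebesgue"
  unfolding circle_lebesgue_def
  by (rule prob_space.prob_space_distr)
    (auto intro!: prob_spaceI measurable_restrict_space1 borel_measurable_circle_of
      simp: emeasure_restrict_space space_restrict_space)

lemma Gamma1_mod_of_lebesgue_preserving:
  assumes "f \<in> E1_mod \<omega>" "measure_preserving_map circle_lebesgue f"
  shows "f \<in> Gamma1_mod \<omega>"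
  unfolding Gamma1_mod_def using assms prob_space_circle_lebesgue
  by (auto simp: absolutely_continuous_def intro!: exI[of _ circle_lebesgue]) (simp_all add: circle_lebesgue_def)

section \<open>A family of circle maps with prescribed modulus\<close>

text \<open>The map whose first inverse branch has slope \<open>p x = q + (1 - 2 q) \<omega> x / \<omega> 1\<close>, which increases from \<open>q\<close> at 0 to
  \<open>1 - q\<close> at 1. Its upper modulus bound comes from the Lipschitz estimates for both branches; the lower
  bound compares the derivative at 0 with the derivative at a nearby point, where
  \<open>p (f1 x) - p 0\<close> is a constant multiple of \<open>\<omega> (f1 x)\<close> and \<open>f1 x \<ge> x\<close>.\<close>

lemma ex_lebesgue_preserving_circle_map:
  assumes \<omega>: "\<omega> \<in> concave_moduli" and q: "0 < q" "q < 1 / 2"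
  shows "\<exists>f \<in> Gamma1_mod \<omega>. measure_preserving_map circle_lebesgue f \<and>
    circle_deriv f (circle_of 0) = 1 / q"
proof -
  define K where "K = (1 - 2 * q) / \<omega> 1"
  define p where "p x = q + K * \<omega> x" for x
  have \<omega>1: "0 < \<omega> 1"
    by (rule concave_moduli_pos[OF \<omega>]) simp
  have \<omega>0: "\<omega> 0 = 0" and \<omega>c: "continuous_on {0..} \<omega>"
    using \<omega> by (auto simp: concave_moduli_def)
  have K: "0 < K"
    using q \<omega>1 by (simp add: K_def)
  have p01: "p 0 = q" "p 1 = 1 - q"
    using \<omega>1 \<omega>0 by (auto simp: p_def K_def)
  have p: "q \<le> p y" "p y \<le> 1 - q" if "y \<in> {0..1}" for y
  proof -
    show "q \<le> p y"
      using K concave_moduli_nonneg[OF \<omega>, of y] that by (simp add: p_def)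
    have "K * \<omega> y \<le> K * \<omega> 1"
      using K concave_moduli_mono[OF \<omega>, of y 1] that by (intro mult_left_mono) auto
    then show "p y \<le> 1 - q"
      using p01 by (simp add: p_def)
  qed
  have p_lip: "\<bar>p s - p t\<bar> \<le> K * \<omega> \<bar>s - t\<bar>" if "s \<in> {0..1}" "t \<in> {0..1}" for s t
  proof -
    have "\<bar>p s - p t\<bar> = K * \<bar>\<omega> s - \<omega> t\<bar>"
      using K by (simp add: p_def abs_mult flip: right_diff_distrib)
    also have "\<dots> \<le> K * \<omega> \<bar>s - t\<bar>"
      using K concave_moduli_diff[OF \<omega>, of s t] that by (intro mult_left_mono) auto
    finally show ?thesis .
  qed
  have "continuous_on {0..1} p"
    unfolding p_def by (intro continuous_intros continuous_on_subset[OF \<omega>c]) auto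
  moreover have "0 < p y \<and> p y < 1" if "y \<in> {0..1}" for y
    using p[OF that] q by linarith
  ultimately obtain a f1 g1 where a: "0 < a" "a < 1" and f1: "has_inverse_branch 0 a f1 g1 p"
    by (rule ex_branch_with_slope)
  obtain f2 where ext: "lebesgue_preserving_extension a f1 f2"
    using ex1_lebesgue_preserving_extension[OF f1 a] by blast
  then have f2: "has_inverse_branch a 1 f2 (\<lambda>y. a + y - g1 y) (\<lambda>y. 1 - p y)"
    using lebesgue_preserving_extension_iff[OF f1 a] by blast
  define f where "f = induced_circle_map (two_branch_map a f1 f2)"
  have C1: "circle_C1 f"
    unfolding f_def extension_circle_C1_iff[OF f1 a ext] using p01 by simp
  define E where "E x = (if x \<le> a then 1 / p (f1 x) else 1 / (1 - p (f2 x)))" for x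
  have deriv: "circle_deriv f r = E (unit_rep r)" for r
    unfolding f_def E_def by (rule circle_deriv_two_branch[OF f1 f2 a]) (use p01 in auto)
  have ends: "f1 0 = 0" "f1 a = 1" "f2 a = 0" "f2 1 = 1"
    using full_branch_endpoints[OF f1] full_branch_endpoints[OF f2] by auto
  have preserve: "measure_preserving_map circle_lebesgue f"
    unfolding f_def
    by (rule measure_preserving_induced_circle_map)
      (use ext borel_measurable_circle_C1 C1 in \<open>auto simp: lebesgue_preserving_extension_def f_def\<close>)
  have "f \<in> E1"
  proof -
    have "1 / (1 - q) \<le> \<bar>E x\<bar>" if "x \<in> {0..1}" for x
    proof -
      have s: "1 / (1 - q) \<le> \<bar>1 / s\<bar>" if "q \<le> s" "s \<le> 1 - q" for s
        using that q by (simp add: frac_le)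
      show ?thesis
        using p[OF full_branch_range(1)[OF f1, of x]] p[OF full_branch_range(1)[OF f2, of x]] that s
        by (auto simp: E_def)
    qed
    then have "1 / (1 - q) \<le> \<bar>circle_deriv f r\<bar>" for r
      using unit_rep_bounds[of r] by (simp add: deriv)
    moreover have "1 < 1 / (1 - q)"
      using q by simp
    ultimately show ?thesis
      unfolding E1_def using C1 by blast
  qed
  define C where "C = K / q ^ 3"
  have C: "0 \<le> C"
    using K q by (simp add: C_def)
  \<comment> \<open>The factor 4 is one factor 2 for the break point \<open>a\<close> and one for the point \<open>0 = 1\<close>.\<close>
  have upper: "\<bar>circle_deriv f r - circle_deriv f s\<bar> \<le> 4 * C * \<omega> (dist r s)" for r s
  proof -
    have left: "\<bar>E x - E y\<bar> \<le> C * \<omega> \<bar>x - y\<bar>" if "x \<in> {0..a}" "y \<in> {0..a}" for x y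
      using full_branch_slope_modulus[OF f1 \<omega> q(1) _ p(1) _ p_lip that] that q K
      by (simp add: E_def C_def)
    have E_right: "E x = 1 / (1 - p (f2 x))" if "x \<in> {a..1}" for x
      using that ends p01 by (cases "x = a") (auto simp: E_def)
    have p': "q \<le> 1 - p y" if "y \<in> {0..1}" for y
      using p(2)[OF that] by simp
    have p'_lip: "\<bar>(1 - p s) - (1 - p t)\<bar> \<le> K * \<omega> \<bar>s - t\<bar>" if "s \<in> {0..1}" "t \<in> {0..1}" for s t
      using p_lip[OF that] by (simp add: abs_minus_commute)
    have right: "\<bar>E x - E y\<bar> \<le> C * \<omega> \<bar>x - y\<bar>" if "x \<in> {a..1}" "y \<in> {a..1}" for x y
      unfolding E_right[OF that(1)] E_right[OF that(2)] C_def
      using full_branch_slope_modulus[OF f2 \<omega> q(1) _ p' _ p'_lip that] q K by simp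
    have "E 0 = E 1"
      using E_right[of 1] a ends p01 by (simp add: E_def)
    then have "\<bar>E (unit_rep r) - E (unit_rep s)\<bar> \<le> 2 * (2 * C) * \<omega> (dist r s)"
      using C modulus_bound_join[OF \<omega> C left right]
      by (intro periodic_modulus_bound[OF \<omega>]) auto
    then show ?thesis
      by (simp add: deriv)
  qed
  have upper_t: "\<bar>circle_deriv f r - circle_deriv f s\<bar> \<le> 4 * C * \<omega> t" if "dist r s < t" for r s t
    using upper[of r s] mult_left_mono[OF concave_moduli_mono[OF \<omega>, of "dist r s" t], of "4 * C"] that C
    by simp
  have lower: "K / 2 * \<omega> t \<le> canonical_modulus (circle_deriv f) t" if t: "0 < t" "t \<le> a" for t
  proof -
    \<comment> \<open>The point \<open>t / 2\<close> rather than \<open>t\<close>, as the modulus at \<open>t\<close> only sees distances strictly below \<open>t\<close>; this costs a factor 2.\<close>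
    have x: "t / 2 \<in> {0..a}"
      using t by simp
    have "K * (1 / 2 * \<omega> t) \<le> K * \<omega> (f1 (t / 2))"
    proof (rule mult_left_mono)
      have "1 / 2 * \<omega> t \<le> \<omega> (1 / 2 * t)"
        by (rule concave_moduli_contraction[OF \<omega>]) (use t in auto)
      also have "\<dots> \<le> \<omega> (f1 (t / 2))"
        using le_full_branch[OF f1 x] t by (intro concave_moduli_mono[OF \<omega>]) auto
      finally show "1 / 2 * \<omega> t \<le> \<omega> (f1 (t / 2))" .
    qed (use K in simp)
    also have "\<dots> = p (f1 (t / 2)) - q"
      by (simp add: p_def)
    \<comment> \<open>The denominator is the product of the inverse slopes at the two points and at most 1.\<close>
    also have "\<dots> \<le> (p (f1 (t / 2)) - q) / (q * p (f1 (t / 2)))"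
    proof -
      have "0 < q * p (f1 (t / 2))" "q * p (f1 (t / 2)) \<le> 1"
        using p[OF full_branch_range(1)[OF f1 x]] q by (auto intro!: mult_le_one mult_pos_pos)
      moreover have "0 \<le> p (f1 (t / 2)) - q"
        using p(1)[OF full_branch_range(1)[OF f1 x]] by simp
      ultimately show ?thesis
        by (simp add: le_divide_eq mult_left_le)
    qed
    also have "\<dots> = E 0 - E (t / 2)"
      using p(1)[OF full_branch_range(1)[OF f1 x]] q x a ends p01 by (simp add: E_def diff_frac_eq)
    also have "\<dots> \<le> \<bar>circle_deriv f (circle_of 0) - circle_deriv f (circle_of (t / 2))\<bar>"
      using x a by (simp add: deriv unit_rep_circle_of frac_eq)
    also have "\<dots> \<le> canonical_modulus (circle_deriv f) t"
    proof (rule le_canonical_modulus)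
      show "dist (circle_of 0) (circle_of (t / 2)) < t"
        using dist_circle_of_le[of 0 "t / 2"] t by simp
    qed (rule upper_t)
    finally show ?thesis
      by simp
  qed
  have "equiv_moduli (canonical_modulus (circle_deriv f)) \<omega>"
    unfolding equiv_moduli_def
  proof (intro exI conjI ballI)
    fix t assume t: "t \<in> {0<..a}"
    then have "0 < \<omega> t"
      by (intro concave_moduli_pos[OF \<omega>]) auto
    then show "K / 2 \<le> canonical_modulus (circle_deriv f) t / \<omega> t"
      using lower[of t] t by (simp add: le_divide_eq)
    show "canonical_modulus (circle_deriv f) t / \<omega> t \<le> 4 * C"
      using canonical_modulus_le[OF _ upper_t, of t] t \<open>0 < \<omega> t\<close> by (simp add: divide_le_eq)
  qed (use a K in auto)
  then have "f \<in> E1_mod \<omega>"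
    unfolding E1_mod_def using \<open>f \<in> E1\<close> by simp
  moreover have "circle_deriv f (circle_of 0) = 1 / q"
    using a ends p01 by (simp add: deriv unit_rep_circle_of E_def)
  ultimately show ?thesis
    using preserve Gamma1_mod_of_lebesgue_preserving by blast
qed

text \<open>The derivative at the point 0 of the circle recovers the parameter \<open>q\<close>, which ranges over an interval.\<close>

lemma uncountable_lebesgue_preserving_circle_maps:
  assumes "\<omega> \<in> concave_moduli"
  shows "uncountable {f \<in> Gamma1_mod \<omega>. measure_preserving_map circle_lebesgue f}" (is "uncountable ?S")
proof
  assume "countable ?S"
  then have "countable ((\<lambda>f. 1 / circle_deriv f (circle_of 0)) ` ?S)"
    by (rule countable_image)
  moreover have "{0<..<1/2} \<subseteq> (\<lambda>f. 1 / circle_deriv f (circle_of 0)) ` ?S"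
  proof
    fix q :: real assume "q \<in> {0<..<1/2}"
    then obtain f where "f \<in> ?S" "circle_deriv f (circle_of 0) = 1 / q"
      using ex_lebesgue_preserving_circle_map[OF assms, of q] by auto
    then show "q \<in> (\<lambda>f. 1 / circle_deriv f (circle_of 0)) ` ?S"
      by (intro image_eqI[of _ _ f]) auto
  qed
  ultimately have "countable {0<..<1/2::real}"
    by (rule countable_subset[rotated])
  then show False
    using uncountable_open_interval[of 0 "1/2::real"] by simp
qed

theorem theorem2:
  "(\<forall>(a::real) (f1::real \<Rightarrow> real).
      0 < a \<and> a < 1 \<and> increasing_full_branch {0..a} f1 \<longrightarrow>
        (\<exists>!f2. f2 \<in> extensional {a..1} \<and> lebesgue_preserving_extension a f1 f2) \<and>
        (\<forall>f2. lebesgue_preserving_extension a f1 f2 \<longrightarrow>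
           (circle_C1 (induced_circle_map (two_branch_map a f1 f2)) \<longleftrightarrow>
            vector_derivative f1 (at 0 within {0..a}) =
              vector_derivative f1 (at a within {0..a}) /
              (vector_derivative f1 (at a within {0..a}) - 1)))) \<and>
   (\<forall>\<omega>\<in>concave_moduli. uncountable {f \<in> Gamma1_mod \<omega>. measure_preserving_map circle_lebesgue f})"
proof (intro conjI allI impI ballI)
  fix a :: real and f1 :: "real \<Rightarrow> real"
  assume "0 < a \<and> a < 1 \<and> increasing_full_branch {0..a} f1"
  then have a: "0 < a" "a < 1" and "increasing_full_branch {0..a} f1"
    by auto
  then obtain d where f1: "has_inverse_branch 0 a f1 (inv_into {0..a} f1) d"
    using inverse_branch_of_full_branch by blast
  show "\<exists>!f2. f2 \<in> extensional {a..1} \<and> lebesgue_preserving_extension a f1 f2"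
    by (rule ex1_lebesgue_preserving_extension[OF f1 a])
  fix f2 assume ext: "lebesgue_preserving_extension a f1 f2"
  show "circle_C1 (induced_circle_map (two_branch_map a f1 f2)) \<longleftrightarrow>
      vector_derivative f1 (at 0 within {0..a}) =
        vector_derivative f1 (at a within {0..a}) / (vector_derivative f1 (at a within {0..a}) - 1)"
    unfolding extension_circle_C1_iff[OF f1 a ext] slope_condition_iff[OF f1 a(1)] ..
next
  fix \<omega> assume "\<omega> \<in> concave_moduli"
  then show "uncountable {f \<in> Gamma1_mod \<omega>. measure_preserving_map circle_lebesgue f}"
    by (rule uncountable_lebesgue_preserving_circle_maps)
qed

end
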